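(* Let $\mathbb{F}$ be a field of characteristic $p>0$, $0\neq h\in\mathbb{F}[x]$, and let $A=A_h$ be the unital subalgebra of the Weyl algebra $A_1$ generated by $x$ and $\hat y=yh$. Let $\mathsf{D}_2:A\oplus A\to A$ be the map $\mathsf{D}_2(\alpha,\beta)=[\beta,x]+[\hat y,\alpha]-F_\alpha(h)$, with $F_\alpha$ as in the context. Then $$\operatorname{im}\mathsf{D}_2=\gcd(h,h')\mathcal{J}\oplus \mathsf{Z}(A)\mathcal{K}h^{p-1}y^{p-1},$$ and consequently, as $\mathsf{Z}(A)$-modules, $$\mathrm{HH}^2(A)\cong \mathcal{J}/\gcd(h,h')\mathcal{J}\ \oplus\ \big(\mathsf{C}_A(x)/\mathsf{Z}(A)\mathcal{K}\big)h^{p-1}y^{p-1}.$$ In particular, $\mathrm{HH}^2(A)\neq 0$ for every $0\neq h\in\mathbb{F}[x]$.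
   Context: The Weyl algebra $A_1$ is generated by $x,y$ with $yx-xy=1$; in $A$ one has $\hat y x-x\hat y=h$, and $h^jy^j\in A$ for all $j\geq0$. $[a,b]=ab-ba$. For $\alpha\in A$, $F_\alpha:\mathbb{F}[x]\to A$ is the linear map with $F_\alpha(x^s)=\sum_{\ell=0}^{s-1}x^\ell\alpha x^{s-\ell-1}$ ($F_\alpha(1)=0$). $\mathsf{Z}(A)$ is the center of $A$ and $\mathsf{C}_A(x)$ the centralizer of $x$ in $A$. $\mathcal{J}=\bigoplus_{j=0}^{p-2}\mathsf{C}_A(x)h^jy^j$. $\varkappa:\mathbb{F}[x]\to\mathbb{F}[x]$ is $\varkappa(g)=g'h-h'g$ and $\mathcal{K}=\operatorname{im}\varkappa$ (a $\mathbb{F}[x^p]$-submodule of $\mathbb{F}[x]\subseteq\mathsf{C}_A(x)$). $\gcd$ is monic. $\mathrm{HH}^2(A)$ is the second Hochschild cohomology of $A$ with coefficients in $A$, a $\mathsf{Z}(A)$-module. *)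

theory Defs
  imports "HOL-Computational_Algebra.Computational_Algebra"
begin

text \<open>
Model of the Weyl algebra A_1 over a field 'a.  An element is written in normal
form  sum_j f_j(x) y^j  (polynomials in x on the left of powers of y) and is
represented by the polynomial in y with coefficients in F[x], i.e. by an
element of type 'a poly poly: coefficient j is f_j.  Addition, negation and
zero are those of 'a poly poly; the Weyl product is defined below, using
y g = g y + g' (so y^j g = sum_k (j choose k) g^(k) y^(j-k)), which encodes yx - xy = 1.
\<close>

type_synonym 'a weyl = "'a poly poly"

definition weyl_mult :: "'a::field weyl \<Rightarrow> 'a weyl \<Rightarrow> 'a weyl" where
  "weyl_mult a b =
     (\<Sum>j\<le>degree a. \<Sum>k\<le>j. \<Sum>l\<le>degree b.
        monom (smult (of_nat (j choose k)) (coeff a j * (pderiv ^^ k) (coeff b l))) (j - k + l))"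

definition wpoly :: "'a::field poly \<Rightarrow> 'a weyl" where
  "wpoly f = [:f:]"

definition wscale :: "'a::field \<Rightarrow> 'a weyl \<Rightarrow> 'a weyl" where
  "wscale c a = smult [:c:] a"

definition wX :: "'a::field weyl" where
  "wX = wpoly [:0, 1:]"

definition wY :: "'a::field weyl" where
  "wY = monom 1 1"

definition wxy :: "'a::field poly \<Rightarrow> nat \<Rightarrow> 'a weyl" where
  "wxy f j = monom f j"

definition wYhat :: "'a::field poly \<Rightarrow> 'a weyl" where
  "wYhat h = weyl_mult wY (wpoly h)"

definition wcomm :: "'a::field weyl \<Rightarrow> 'a weyl \<Rightarrow> 'a weyl" where
  "wcomm a b = weyl_mult a b - weyl_mult b a"

inductive_set weylA :: "'a::field poly \<Rightarrow> 'a weyl set" for h where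
  one: "wpoly 1 \<in> weylA h"
| gen_x: "wX \<in> weylA h"
| gen_yhat: "wYhat h \<in> weylA h"
| add: "a \<in> weylA h \<Longrightarrow> b \<in> weylA h \<Longrightarrow> a + b \<in> weylA h"
| scale: "a \<in> weylA h \<Longrightarrow> wscale c a \<in> weylA h"
| mult: "a \<in> weylA h \<Longrightarrow> b \<in> weylA h \<Longrightarrow> weyl_mult a b \<in> weylA h"

definition centerA :: "'a::field poly \<Rightarrow> 'a weyl set" where
  "centerA h = {a \<in> weylA h. \<forall>b\<in>weylA h. weyl_mult a b = weyl_mult b a}"

definition centralizerA_x :: "'a::field poly \<Rightarrow> 'a weyl set" where
  "centralizerA_x h = {a \<in> weylA h. weyl_mult a wX = weyl_mult wX a}"

definition F_map :: "'a::field weyl \<Rightarrow> 'a poly \<Rightarrow> 'a weyl" where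
  "F_map \<alpha> g = (\<Sum>s\<le>degree g. wscale (coeff g s)
      (\<Sum>l<s. weyl_mult (weyl_mult (wpoly (monom 1 l)) \<alpha>) (wpoly (monom 1 (s - l - 1)))))"

definition D2 :: "'a::field poly \<Rightarrow> 'a weyl \<Rightarrow> 'a weyl \<Rightarrow> 'a weyl" where
  "D2 h \<alpha> \<beta> = wcomm \<beta> wX + wcomm (wYhat h) \<alpha> - F_map \<alpha> h"

definition imD2 :: "'a::field poly \<Rightarrow> 'a weyl set" where
  "imD2 h = {D2 h \<alpha> \<beta> | \<alpha> \<beta>. \<alpha> \<in> weylA h \<and> \<beta> \<in> weylA h}"

definition Jset :: "'a::field poly \<Rightarrow> nat \<Rightarrow> 'a weyl set" where
  "Jset h p = {\<Sum>j<p - 1. weyl_mult (c j) (wxy (h ^ j) j) | c.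
                  \<forall>j<p - 1. c j \<in> centralizerA_x h}"

definition kappa :: "'a::field poly \<Rightarrow> 'a poly \<Rightarrow> 'a poly" where
  "kappa h g = pderiv g * h - pderiv h * g"

definition Kset :: "'a::field poly \<Rightarrow> 'a poly set" where
  "Kset h = range (kappa h)"

definition ZKset :: "'a::field poly \<Rightarrow> 'a weyl set" where
  "ZKset h = {\<Sum>i<(n::nat). weyl_mult (z i) (wpoly (k i)) | n z k.
             \<forall>i<n. z i \<in> centerA h \<and> k i \<in> Kset h}"

definition lmult_set :: "'a::field weyl \<Rightarrow> 'a weyl set \<Rightarrow> 'a weyl set" where
  "lmult_set c S = {weyl_mult c u | u. u \<in> S}"

definition rmult_set :: "'a::field weyl set \<Rightarrow> 'a weyl \<Rightarrow> 'a weyl set" where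
  "rmult_set S c = {weyl_mult u c | u. u \<in> S}"

definition is_lin1 :: "'a::field poly \<Rightarrow> ('a weyl \<Rightarrow> 'a weyl) \<Rightarrow> bool" where
  "is_lin1 h g \<longleftrightarrow> (\<forall>a\<in>weylA h. g a \<in> weylA h) \<and>
     (\<forall>a\<in>weylA h. \<forall>b\<in>weylA h. g (a + b) = g a + g b) \<and>
     (\<forall>c. \<forall>a\<in>weylA h. g (wscale c a) = wscale c (g a))"

definition is_cochain2 :: "'a::field poly \<Rightarrow> ('a weyl \<Rightarrow> 'a weyl \<Rightarrow> 'a weyl) \<Rightarrow> bool" where
  "is_cochain2 h f \<longleftrightarrow> (\<forall>a\<in>weylA h. is_lin1 h (f a)) \<and> (\<forall>b\<in>weylA h. is_lin1 h (\<lambda>a. f a b))"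

definition is_cocycle2 :: "'a::field poly \<Rightarrow> ('a weyl \<Rightarrow> 'a weyl \<Rightarrow> 'a weyl) \<Rightarrow> bool" where
  "is_cocycle2 h f \<longleftrightarrow> is_cochain2 h f \<and>
     (\<forall>a\<in>weylA h. \<forall>b\<in>weylA h. \<forall>c\<in>weylA h.
        weyl_mult a (f b c) - f (weyl_mult a b) c + f a (weyl_mult b c) - weyl_mult (f a b) c = 0)"

definition is_coboundary2 :: "'a::field poly \<Rightarrow> ('a weyl \<Rightarrow> 'a weyl \<Rightarrow> 'a weyl) \<Rightarrow> bool" where
  "is_coboundary2 h f \<longleftrightarrow> (\<exists>g. is_lin1 h g \<and>
     (\<forall>a\<in>weylA h. \<forall>b\<in>weylA h. f a b = weyl_mult a (g b) - g (weyl_mult a b) + weyl_mult (g a) b))"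

text \<open>HH^2(A) is the quotient of cocycles by coboundaries; it is nonzero iff some
 cocycle is not a coboundary.  The Z(A)-action on cochains is (z.f)(a,b) = z f(a,b).\<close>

text \<open>An isomorphism of Z(A)-modules HH^2(A) = Coc/Cob  \<cong>  (T1/N1) \<oplus> (T2/N2), encoded through a
 representative-choosing map Phi from cocycles to T1 x T2: Phi induces a well-defined,
 injective (iff clause), surjective, additive and Z(A)-linear map on the quotients.
 Every such isomorphism arises this way (choose representatives).\<close>
definition HH2_iso :: "'a::field poly \<Rightarrow> 'a weyl set \<Rightarrow> 'a weyl set \<Rightarrow> 'a weyl set \<Rightarrow> 'a weyl set \<Rightarrow> bool" where
  "HH2_iso h T1 N1 T2 N2 \<longleftrightarrow>
    (\<exists>\<Phi> :: ('a weyl \<Rightarrow> 'a weyl \<Rightarrow> 'a weyl) \<Rightarrow> 'a weyl \<times> 'a weyl.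
      (\<forall>f. is_cocycle2 h f \<longrightarrow> fst (\<Phi> f) \<in> T1 \<and> snd (\<Phi> f) \<in> T2) \<and>
      (\<forall>f f'. is_cocycle2 h f \<longrightarrow> is_cocycle2 h f' \<longrightarrow>
         (is_coboundary2 h (\<lambda>a b. f a b - f' a b) \<longleftrightarrow>
           fst (\<Phi> f) - fst (\<Phi> f') \<in> N1 \<and> snd (\<Phi> f) - snd (\<Phi> f') \<in> N2)) \<and>
      (\<forall>u\<in>T1. \<forall>v\<in>T2. \<exists>f. is_cocycle2 h f \<and> fst (\<Phi> f) - u \<in> N1 \<and> snd (\<Phi> f) - v \<in> N2) \<and>
      (\<forall>f f'. is_cocycle2 h f \<longrightarrow> is_cocycle2 h f' \<longrightarrow>
         fst (\<Phi> (\<lambda>a b. f a b + f' a b)) - (fst (\<Phi> f) + fst (\<Phi> f')) \<in> N1 \<and>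
         snd (\<Phi> (\<lambda>a b. f a b + f' a b)) - (snd (\<Phi> f) + snd (\<Phi> f')) \<in> N2) \<and>
      (\<forall>z\<in>centerA h. \<forall>f. is_cocycle2 h f \<longrightarrow>
         fst (\<Phi> (\<lambda>a b. weyl_mult z (f a b))) - weyl_mult z (fst (\<Phi> f)) \<in> N1 \<and>
         snd (\<Phi> (\<lambda>a b. weyl_mult z (f a b))) - weyl_mult z (snd (\<Phi> f)) \<in> N2))"

end

theory Submission
  imports Defs
begin

text \<open>A 2-cocycle \<open>f\<close> is a square-zero extension \<open>E\<close> of \<open>A\<close> by \<open>A\<close>. Lifting \<open>x\<close> and \<open>y h\<close> to \<open>E\<close> turns
  the only defining relation \<open>y h x - x y h = h\<close> into an element of \<open>A\<close>, the obstruction of \<open>f\<close>;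
  changing the two lifts by \<open>\<alpha>\<close>, \<open>\<beta>\<close> changes it by \<open>D\<^sub>2(\<alpha>, \<beta>)\<close>. Since there are no further
  relations, \<open>E\<close> splits iff the obstruction lies in \<open>im D\<^sub>2\<close>, and every element of \<open>A\<close> is an
  obstruction, so \<open>HH\<^sup>2(A)\<close> is the cokernel of \<open>D\<^sub>2\<close>.

  To compute the image, note that \<open>[\<cdot>, x]\<close> is formal differentiation with respect to \<open>y\<close> on normal
  forms. Modulo \<open>[A, x]\<close>, the map \<open>\<alpha> \<mapsto> D\<^sub>2(\<alpha>, 0)\<close> acts by \<open>\<kappa>\<close> on the coefficients with respect to the
  basis \<open>h\<^sup>j y\<^sup>j\<close>, so the image can be read off degree by degree. It is not all of \<open>A\<close>
  because \<open>h\<^sup>p\<^sup>-\<^sup>2 \<kappa>(g) = (g h\<^sup>p\<^sup>-\<^sup>1)'\<close> and a derivative in characteristic \<open>p\<close> has no terms of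
  degree \<open>-1\<close> modulo \<open>p\<close>.\<close>

section \<open>The ring structure of the Weyl algebra\<close>

notation weyl_mult (infixl "\<odot>" 70)

text \<open>This is differentiation with respect to x and equals the commutator [y, _]; in contrast,
  \<open>pderiv\<close> on \<open>'a weyl\<close> differentiates with respect to y and equals the
  commutator [_, x].\<close>

definition cderiv :: "'a::field weyl \<Rightarrow> 'a weyl" where
  "cderiv = map_poly pderiv"

definition ymul :: "'a::field weyl \<Rightarrow> 'a weyl" where
  "ymul b = pCons 0 b + cderiv b"

lemma coeff_cderiv [simp]: "coeff (cderiv b) n = pderiv (coeff b n)"
  by (simp add: cderiv_def coeff_map_poly)

lemma cderiv_0 [simp]: "cderiv 0 = 0"
  by (simp add: poly_eq_iff)

lemma cderiv_monom: "cderiv (monom g l) = monom (pderiv g) l"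
  by (simp add: poly_eq_iff)

lemma smult_sum_right: "smult c (sum f S) = (\<Sum>i\<in>S. smult c (f i))"
  by (induction S rule: infinite_finite_induct) (simp_all add: smult_add_right)

lemma ymul_add: "ymul (a + b) = ymul a + ymul b"
  by (simp add: ymul_def poly_eq_iff coeff_pCons pderiv_add split: nat.splits)

lemma ymul_0 [simp]: "ymul 0 = 0"
  by (simp add: ymul_def)

lemma ymul_monom: "ymul (monom g l) = monom g (Suc l) + monom (pderiv g) l"
  by (simp add: ymul_def cderiv_monom monom_Suc)

lemma ymul_smult: "ymul (smult g b) = smult g (ymul b) + smult (pderiv g) b"
  by (simp add: ymul_def poly_eq_iff coeff_pCons pderiv_mult algebra_simps split: nat.splits)

lemma ymul_funpow_add: "(ymul ^^ j) (a + b) = (ymul ^^ j) a + (ymul ^^ j) b"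
  by (induction j) (simp_all add: ymul_add)

lemma ymul_funpow_0 [simp]: "(ymul ^^ j) 0 = 0"
  by (induction j) simp_all

lemma ymul_funpow_sum: "(ymul ^^ j) (sum f S) = (\<Sum>i\<in>S. (ymul ^^ j) (f i))"
  by (induction S rule: infinite_finite_induct) (simp_all add: ymul_funpow_add)

text \<open>The Leibniz rule for y^j g, in the shape used by \<open>weyl_mult_def\<close>; the
  induction is Pascal's rule.\<close>

lemma ymul_funpow_monom:
  "(ymul ^^ j) (monom g l) =
     (\<Sum>k\<le>j. monom (smult (of_nat (j choose k)) ((pderiv ^^ k) g)) (j - k + l))"
proof (induction j arbitrary: g l)
  case (Suc j)
  let ?m = "\<lambda>c k. monom (smult (of_nat c) ((pderiv ^^ k) g)) (Suc j - k + l)"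
  \<comment> \<open>The added term k = Suc j has binomial coefficient zero; with it the two sums
    line up for Pascal's rule.\<close>
  have 1: "(\<Sum>k\<le>j. monom (smult (of_nat (j choose k)) ((pderiv ^^ k) g)) (j - k + Suc l))
      = (\<Sum>k\<le>Suc j. ?m (j choose k) k)"
    by (simp add: Suc_diff_le binomial_eq_0)
  have 2: "(\<Sum>k\<le>j. monom (smult (of_nat (j choose k)) ((pderiv ^^ k) (pderiv g))) (j - k + l))
      = (\<Sum>k\<le>j. ?m (j choose k) (Suc k))"
    by (simp add: funpow_swap1)
  have "(ymul ^^ Suc j) (monom g l) = (\<Sum>k\<le>Suc j. ?m (j choose k) k) + (\<Sum>k\<le>j. ?m (j choose k) (Suc k))"
    unfolding funpow_Suc_right o_apply ymul_monom ymul_funpow_add Suc.IH 1 2 ..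
  also have "\<dots> = (\<Sum>k\<le>Suc j. ?m (Suc j choose k) k)"
    unfolding sum.atMost_Suc_shift
    by (simp add: sum.distrib [symmetric] add_monom smult_add_left add_ac)
  finally show ?case .
qed simp

text \<open>Reads the left factor as an operator: f_j y^j acts as j applications of
  \<open>ymul\<close> followed by multiplication with f_j. The ring laws are proved from this
  form.\<close>

lemma weyl_mult_altdef:
  "a \<odot> b = (\<Sum>j\<le>degree a. smult (coeff a j) ((ymul ^^ j) b))"
proof -
  have "(ymul ^^ j) b = (\<Sum>l\<le>degree b. \<Sum>k\<le>j. monom (smult (of_nat (j choose k)) ((pderiv ^^ k) (coeff b l))) (j - k + l))" for j
    by (subst poly_as_sum_of_monoms [symmetric, of b]) (simp only: ymul_funpow_sum ymul_funpow_monom)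
  then show ?thesis
    unfolding weyl_mult_def
    apply (intro sum.cong refl)
    apply (simp only: smult_sum_right smult_monom mult_smult_right)
    by (rule sum.swap)
qed

lemma weyl_mult_eq_sum:
  assumes "degree a \<le> n"
  shows "a \<odot> b = (\<Sum>j\<le>n. smult (coeff a j) ((ymul ^^ j) b))"
  unfolding weyl_mult_altdef using assms
  by (intro sum.mono_neutral_left) (auto simp: coeff_eq_0)

lemma weyl_mult_add_left: "(a + b) \<odot> c = a \<odot> c + b \<odot> c"
proof -
  let ?n = "max (degree a) (degree b)"
  have "degree (a + b) \<le> ?n" by (rule degree_add_le_max)
  then show ?thesis
    by (simp add: weyl_mult_eq_sum [where n = ?n] smult_add_left sum.distrib)
qed

lemma weyl_mult_add_right: "a \<odot> (b + c) = a \<odot> b + a \<odot> c"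
  by (simp add: weyl_mult_altdef ymul_funpow_add smult_add_right sum.distrib)

lemma weyl_mult_smult_left: "smult g a \<odot> b = smult g (a \<odot> b)"
  by (simp add: weyl_mult_eq_sum [OF degree_smult_le] weyl_mult_altdef [of a] smult_sum_right)

lemma weyl_mult_0 [simp]: "0 \<odot> b = 0"  "a \<odot> 0 = 0"
  by (simp_all add: weyl_mult_altdef)

lemma weyl_mult_monom_left: "monom g j \<odot> b = smult g ((ymul ^^ j) b)"
proof -
  have "monom g j \<odot> b = (\<Sum>i\<le>j. if i = j then smult g ((ymul ^^ j) b) else 0)"
    unfolding weyl_mult_eq_sum [OF degree_monom_le] by (intro sum.cong) auto
  then show ?thesis by simp
qed

lemma wpoly_weyl_mult: "wpoly g \<odot> b = smult g b"
  by (simp add: wpoly_def weyl_mult_altdef)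

lemma weyl_mult_wpoly_1 [simp]: "a \<odot> wpoly 1 = a"
proof -
  have "(ymul ^^ j) (wpoly 1 :: 'a weyl) = monom 1 j" for j
    by (induction j) (simp_all add: wpoly_def monom_0 [symmetric] ymul_monom)
  then show ?thesis
    by (simp add: weyl_mult_altdef smult_monom poly_as_sum_of_monoms)
qed

lemma poly_monom_induct [case_names zero add monom]:
  assumes "P 0" "\<And>a b. P a \<Longrightarrow> P b \<Longrightarrow> P (a + b)" "\<And>g j. P (monom g j)"
  shows "P (a :: 'a::comm_monoid_add poly)"
proof -
  have "P (\<Sum>i\<in>S. monom (coeff a i) i)" if "finite S" for S
    using that by induction (simp_all add: assms)
  from this [of "{..degree a}"] show ?thesis by (simp add: poly_as_sum_of_monoms)
qed

lemma ymul_weyl_mult: "ymul b \<odot> c = ymul (b \<odot> c)"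
proof (induction b rule: poly_monom_induct)
  case (monom g l)
  then show ?case
    by (simp add: ymul_monom weyl_mult_add_left weyl_mult_monom_left ymul_smult)
qed (simp_all add: weyl_mult_add_left ymul_add)

text \<open>Left multiplication by g y^j is g times the j-fold iterate of \<open>ymul\<close>, so
  everything reduces to (y b) c = y (b c), which is \<open>ymul_weyl_mult\<close>.\<close>

lemma weyl_mult_assoc: "(a \<odot> b) \<odot> c = a \<odot> (b \<odot> c)"
proof (induction a rule: poly_monom_induct)
  case (monom g j)
  have "(ymul ^^ j) b \<odot> c = (ymul ^^ j) (b \<odot> c)"
    by (induction j) (simp_all add: ymul_weyl_mult)
  then show ?case by (simp add: weyl_mult_monom_left weyl_mult_smult_left)
qed (simp_all add: weyl_mult_add_left)

interpretation weyl: ring "(+)" 0 "(-)" uminus weyl_mult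
  by unfold_locales (simp_all add: weyl_mult_assoc weyl_mult_add_left weyl_mult_add_right)

lemma weyl_mult_sum_left: "sum f S \<odot> b = (\<Sum>i\<in>S. f i \<odot> b)"
  by (induction S rule: infinite_finite_induct) (simp_all add: weyl_mult_add_left)

lemma weyl_mult_sum_right: "a \<odot> sum f S = (\<Sum>i\<in>S. a \<odot> f i)"
  by (induction S rule: infinite_finite_induct) (simp_all add: weyl_mult_add_right)

lemma wpoly_1_weyl_mult [simp]: "wpoly 1 \<odot> a = a"
  by (simp add: wpoly_weyl_mult)

lemma wpoly_0 [simp]: "wpoly 0 = 0"
  by (simp add: wpoly_def)

lemma wpoly_add: "wpoly (s + t) = wpoly s + wpoly t"
  by (simp add: wpoly_def)

lemma wpoly_mult: "wpoly (s * t) = wpoly s \<odot> wpoly t"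
  unfolding wpoly_weyl_mult by (simp add: wpoly_def)

lemma wpoly_smult: "wpoly (smult c t) = wscale c (wpoly t)"
  by (simp add: wpoly_def wscale_def)

lemma wscale_conv_weyl_mult: "wscale c a = wpoly [:c:] \<odot> a"
  by (simp add: wscale_def wpoly_weyl_mult)

lemma ymul_wscale: "ymul (wscale c a) = wscale c (ymul a)"
  by (simp add: wscale_def ymul_smult)

lemma weyl_mult_wscale_right: "a \<odot> wscale c b = wscale c (a \<odot> b)"
proof -
  have "(ymul ^^ j) (wscale c b) = wscale c ((ymul ^^ j) b)" for j
    by (induction j) (simp_all add: ymul_wscale)
  then show ?thesis
    unfolding weyl_mult_altdef by (simp add: wscale_def smult_sum_right mult.commute)
qed

lemma weyl_mult_wscale_left: "wscale c a \<odot> b = wscale c (a \<odot> b)"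
  by (simp add: wscale_conv_weyl_mult weyl_mult_assoc)

lemma wscale_add_right: "wscale c (a + b) = wscale c a + wscale c b"
  and wscale_diff_right: "wscale c (a - b) = wscale c a - wscale c b"
  and wscale_add_left: "wscale (c + d) a = wscale c a + wscale d a"
  and wscale_wscale: "wscale c (wscale d a) = wscale (c * d) a"
  and wscale_0 [simp]: "wscale 0 a = 0" "wscale c 0 = 0"
  and wscale_1 [simp]: "wscale 1 a = a"
  and wscale_neg1: "wscale (- 1) a = - a"
  by (simp_all add: wscale_def smult_add_right smult_diff_right smult_add_left flip: one_pCons)
     (simp_all add: poly_eq_iff distrib_right)

lemma wscale_sum_right: "wscale c (sum f S) = (\<Sum>i\<in>S. wscale c (f i))"
  by (simp add: wscale_def smult_sum_right)

lemma wX_weyl_mult_monom: "wX \<odot> wpoly (monom 1 n) = wpoly (monom 1 (Suc n))"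
  by (simp add: wX_def monom_Suc flip: wpoly_mult)

lemma wpoly_pCons: "wpoly (pCons c t) = wscale c (wpoly 1) + wX \<odot> wpoly t"
  by (simp add: wX_def wpoly_weyl_mult) (simp add: wpoly_def wscale_def)

lemma wY_weyl_mult: "wY \<odot> b = ymul b"
  by (simp add: wY_def weyl_mult_monom_left)

lemma wYhat_weyl_mult: "wYhat h \<odot> b = ymul (smult h b)"
  unfolding wYhat_def weyl_mult_assoc by (simp add: wY_weyl_mult wpoly_weyl_mult)

lemma wYhat_eq: "wYhat h = monom h 1 + wpoly (pderiv h)"
  by (simp add: wYhat_def wY_weyl_mult wpoly_def ymul_monom flip: monom_0)

lemma wYhat_comm_wpoly: "wYhat h \<odot> wpoly t = wpoly t \<odot> wYhat h + wpoly (pderiv t * h)"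
  by (subst wYhat_weyl_mult, subst wpoly_weyl_mult, subst wYhat_eq)
     (simp add: wpoly_def ymul_monom pderiv_mult smult_monom smult_add_right algebra_simps
        flip: monom_0 add_monom)

lemma ymul_wX_mult: "ymul (wX \<odot> b) = wX \<odot> ymul b + b"
  by (simp add: wX_def wpoly_weyl_mult ymul_smult pderiv_pCons flip: one_pCons)

text \<open>This is y^j x = x y^j + j y^(j-1), extended linearly over F[x] from the left.\<close>

lemma weyl_mult_wX: "a \<odot> wX = wX \<odot> a + pderiv a"
proof (induction a rule: poly_monom_induct)
  case (monom g j)
  have *: "(ymul ^^ j) (wX :: 'b :: field weyl) = wX \<odot> monom 1 j + pderiv (monom 1 j)"
  proof (induction j)
    case 0
    show ?case
      by (simp add: wX_def wpoly_weyl_mult pderiv_monom) (simp add: wpoly_def monom_0)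
  next
    case (Suc j)
    have "ymul (pderiv (monom 1 j)) + monom 1 j = pderiv (monom (1 :: 'b poly) (Suc j))"
      by (cases j) (simp_all add: pderiv_monom ymul_monom add_monom add_ac pderiv_add)
    with Suc show ?case
      by (simp add: ymul_add ymul_wX_mult ymul_monom add_ac)
  qed
  show ?case
    unfolding weyl_mult_monom_left *
    by (simp add: smult_add_right pderiv_monom) (simp add: wX_def wpoly_weyl_mult smult_monom mult_ac)
qed (simp_all add: weyl_mult_add_left weyl_mult_add_right pderiv_add)

section \<open>Normal forms in the subalgebra\<close>

text \<open>Multiplication by h^j y^j preserves the divisibility condition that will characterize A.
  Coefficient k of y c is c_(k-1) + c_k'. The shifted term is repaired by one more factor h; for the
  other one, h^(j+1) c_k' = h (h^j c_k)' - j h' h^j c_k, and h (h^k r)' is again divisible by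
  h^k.\<close>

lemma dvd_ymul_funpow:
  assumes "\<And>k. h ^ k dvd coeff b k"
  shows "h ^ k dvd h ^ j * coeff ((ymul ^^ j) b) k"
proof (induction j arbitrary: k)
  case (Suc j)
  define c where "c = (ymul ^^ j) b"
  have "h ^ k dvd h * (h ^ j * coeff c (k - 1))" if "k > 0"
    using Suc.IH [of "k - 1"] that by (cases k) (auto simp: c_def intro: mult_dvd_mono)
  moreover have "h ^ k dvd h ^ Suc j * pderiv (coeff c k)"
  proof -
    obtain r where r: "h ^ j * coeff c k = h ^ k * r"
      using Suc.IH [of k] by (auto simp: c_def)
    have "h ^ Suc j * pderiv (coeff c k) =
        h * pderiv (h ^ j * coeff c k) - h * pderiv (h ^ j) * coeff c k"
      by (simp add: pderiv_mult algebra_simps)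
    also have "h * pderiv (h ^ j) * coeff c k = smult (of_nat j) (pderiv h * (h ^ j * coeff c k))"
      by (cases j) (simp_all add: pderiv_power_Suc algebra_simps del: power_Suc, simp add: mult_ac)
    also have "h * pderiv (h ^ j * coeff c k) = h ^ k * (h * pderiv r + smult (of_nat k) (pderiv h * r))"
      unfolding r by (cases k) (simp_all add: pderiv_mult pderiv_power_Suc algebra_simps del: power_Suc, simp add: mult_ac)
    finally show ?thesis
      unfolding r by (auto intro!: dvd_diff dvd_smult)
  qed
  moreover have "(ymul ^^ Suc j) b = ymul c"
    by (simp add: c_def)
  ultimately show ?case
    by (cases k) (auto simp del: funpow.simps simp: ymul_def [of c] coeff_pCons distrib_left mult_ac intro: dvd_add)
qed (use assms in simp)

lemma wpoly_in_weylA: "wpoly t \<in> weylA h"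
proof (induction t)
  case (pCons c t)
  then show ?case by (auto simp: wpoly_pCons intro: weylA.intros)
next
  case 0
  have "wpoly 0 = wscale 0 (wpoly 1)" by simp
  then show ?case using weylA.one weylA.scale by metis
qed

text \<open>For h \<noteq> 0 these elements x^n h^j y^j form an F-basis of A:
  \<open>weylA_linear_induct\<close> expresses that they span, \<open>weylA_linear_extension\<close>
  that they are independent.\<close>

definition wbasis :: "'a::field poly \<Rightarrow> nat \<Rightarrow> nat \<Rightarrow> 'a weyl" where
  "wbasis h n j = monom (monom 1 n * h ^ j) j"

lemma wbasis_0_0: "wbasis h 0 0 = wpoly 1"
  by (simp add: wbasis_def wpoly_def monom_0)

lemma wbasis_conv: "wbasis h n j = wpoly (monom 1 n) \<odot> wbasis h 0 j"
  by (simp add: wbasis_def wpoly_weyl_mult smult_monom)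

lemma wX_wbasis: "wX \<odot> wbasis h n j = wbasis h (Suc n) j"
  by (simp add: wbasis_def wX_def wpoly_weyl_mult smult_monom monom_Suc mult_pCons_left)

text \<open>The recursion in j that puts the basis inside A and later defines linear maps on A
  degree by degree in y.\<close>

lemma wYhat_wbasis:
  "wYhat h \<odot> wbasis h 0 j = wbasis h 0 (Suc j) + wpoly (of_nat (Suc j) * pderiv h) \<odot> wbasis h 0 j"
proof -
  have "ymul (monom (h ^ Suc j) j) = monom (h ^ Suc j) (Suc j) + monom (of_nat (Suc j) * pderiv h * h ^ j) j"
    unfolding ymul_monom pderiv_power_Suc by (simp add: of_nat_poly mult_ac)
  then show ?thesis
    by (simp add: wYhat_weyl_mult wbasis_def wpoly_weyl_mult smult_monom)
qed

lemma weylA_0: "0 \<in> weylA h"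
  using wpoly_in_weylA [of 0 h] by simp

lemma weylA_minus: "a \<in> weylA h \<Longrightarrow> - a \<in> weylA h"
  using weylA.scale [of a h "- 1"] by (simp add: wscale_neg1)

lemma weylA_diff: "a \<in> weylA h \<Longrightarrow> b \<in> weylA h \<Longrightarrow> a - b \<in> weylA h"
  using weylA.add [of a h "- b"] weylA_minus [of b h] by simp

lemma weylA_sum: "(\<And>i. i \<in> S \<Longrightarrow> f i \<in> weylA h) \<Longrightarrow> sum f S \<in> weylA h"
  by (induction S rule: infinite_finite_induct) (auto intro: weylA.add weylA_0)

lemma wbasis_in_weylA: "wbasis h n j \<in> weylA h"
proof -
  have "wbasis h 0 j \<in> weylA h"
  proof (induction j)
    case (Suc j)
    have "wbasis h 0 (Suc j) = wYhat h \<odot> wbasis h 0 j - wpoly (of_nat (Suc j) * pderiv h) \<odot> wbasis h 0 j"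
      by (simp add: wYhat_wbasis)
    with Suc show ?case
      by (metis weylA_diff weylA.mult weylA.gen_yhat wpoly_in_weylA)
  qed (simp add: wbasis_0_0 weylA.one)
  then show ?thesis
    unfolding wbasis_conv [of h n] by (intro weylA.mult wpoly_in_weylA)
qed

lemmas weylA_intros = weylA.intros weylA_0 weylA_minus weylA_diff weylA_sum wpoly_in_weylA wbasis_in_weylA

text \<open>So A is the direct sum of the F[x] h^j y^j. Closure under products is the only real
  case: the factor h^j contained in the coefficient of y^j is exactly what
  \<open>dvd_ymul_funpow\<close> consumes.\<close>

lemma weylA_iff: "a \<in> weylA h \<longleftrightarrow> (\<forall>j. h ^ j dvd coeff a j)"
proof
  show "\<forall>j. h ^ j dvd coeff a j" if "a \<in> weylA h" using that
  proof induction
    case (mult a b)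
    have "h ^ k dvd coeff (smult (coeff a j) ((ymul ^^ j) b)) k" for j k
    proof -
      obtain r where "coeff a j = r * h ^ j" using mult by (metis dvdE mult.commute)
      then show ?thesis
        using dvd_ymul_funpow [of h b k j] mult by (simp add: mult.assoc)
    qed
    then show ?case
      by (auto simp: weyl_mult_altdef coeff_sum intro!: dvd_sum)
  qed (auto simp: wpoly_def wX_def wYhat_eq wscale_def coeff_pCons intro: dvd_add dvd_smult split: nat.splits)
next
  assume *: "\<forall>j. h ^ j dvd coeff a j"
  have "monom (coeff a j) j \<in> weylA h" for j
  proof -
    obtain t where "coeff a j = t * h ^ j" using * by (metis dvdE mult.commute)
    then have "monom (coeff a j) j = wpoly t \<odot> wbasis h 0 j"
      by (simp add: wbasis_def wpoly_weyl_mult smult_monom)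
    then show ?thesis by (metis weylA.mult wpoly_in_weylA wbasis_in_weylA)
  qed
  then have "(\<Sum>j\<le>degree a. monom (coeff a j) j) \<in> weylA h" by (rule weylA_sum)
  then show "a \<in> weylA h" by (simp add: poly_as_sum_of_monoms)
qed

lemma weylA_linear_induct [consumes 1, case_names add scale basis]:
  assumes "a \<in> weylA h"
    and add: "\<And>a b. a \<in> weylA h \<Longrightarrow> b \<in> weylA h \<Longrightarrow> P a \<Longrightarrow> P b \<Longrightarrow> P (a + b)"
    and scale: "\<And>c a. a \<in> weylA h \<Longrightarrow> P a \<Longrightarrow> P (wscale c a)"
    and basis: "\<And>n j. P (wbasis h n j)"
  shows "P a"
proof -
  have P0: "P 0" using scale [OF wbasis_in_weylA basis, of 0] by simp
  have P_sum: "P (sum f S)" if "finite S" "\<And>i. i \<in> S \<Longrightarrow> f i \<in> weylA h \<and> P (f i)" for f :: "nat \<Rightarrow> _" and S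
    using that by (induction S) (auto intro: P0 add weylA_sum)
  have "monom (coeff a j) j \<in> weylA h \<and> P (monom (coeff a j) j)" for j
  proof -
    obtain t where t: "coeff a j = t * h ^ j" using assms(1) by (metis weylA_iff dvdE mult.commute)
    have "monom (coeff a j) j = (\<Sum>n\<le>degree t. wscale (coeff t n) (wbasis h n j))" (is "_ = ?s")
    proof -
      have "?s = monom ((\<Sum>n\<le>degree t. monom (coeff t n) n) * h ^ j) j"
        by (simp add: wscale_def wbasis_def smult_monom mult.assoc sum_distrib_right flip: monom_sum)
           (simp add: smult_monom flip: mult_smult_left)
      then show ?thesis by (simp add: poly_as_sum_of_monoms t)
    qed
    then show ?thesis by (auto intro!: P_sum scale basis weylA_intros)
  qed
  then have "P (\<Sum>j\<le>degree a. monom (coeff a j) j)" by (intro P_sum) auto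
  then show ?thesis by (simp add: poly_as_sum_of_monoms)
qed

text \<open>Extends additive functions of the single coefficients to polynomials. It is nested
  below: the outer fold runs over powers of y, the inner one over powers of x.\<close>

definition poly_fold :: "(nat \<Rightarrow> 'a::zero \<Rightarrow> 'b::comm_monoid_add) \<Rightarrow> 'a poly \<Rightarrow> 'b" where
  "poly_fold w p = (\<Sum>n\<le>degree p. w n (coeff p n))"

lemma poly_fold_eq_sum:
  assumes "degree p \<le> m" "\<And>n. w n 0 = 0"
  shows "poly_fold w p = (\<Sum>n\<le>m. w n (coeff p n))"
  unfolding poly_fold_def using assms
  by (intro sum.mono_neutral_left) (auto simp: coeff_eq_0)

lemma poly_fold_add:
  assumes "\<And>n. w n 0 = 0" "\<And>n a b. w n (a + b) = w n a + w n b"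
  shows "poly_fold w (p + q) = poly_fold w p + poly_fold w q"
proof -
  let ?n = "max (degree p) (degree q)"
  have "degree (p + q) \<le> ?n" by (rule degree_add_le_max)
  then show ?thesis
    by (simp add: poly_fold_eq_sum [where m = ?n] assms sum.distrib)
qed

lemma poly_fold_monom:
  assumes "\<And>n. w n 0 = 0"
  shows "poly_fold w (monom c n) = w n c"
proof -
  have "poly_fold w (monom c n) = (\<Sum>i\<le>n. if i = n then w n c else 0)"
    unfolding poly_fold_eq_sum [where w = w, OF degree_monom_le assms] by (intro sum.cong) (auto simp: assms)
  then show ?thesis by simp
qed

lemma weylA_linear_extension:
  assumes "h \<noteq> 0" and v: "\<And>n j. v n j \<in> weylA h"
  shows "\<exists>g. is_lin1 h g \<and> (\<forall>n j. g (wbasis h n j) = v n j)"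
proof -
  define w where "w j = poly_fold (\<lambda>n s. wscale s (v n j))" for j
  \<comment> \<open>Division by h^j recovers t from a coefficient t h^j. As \<open>div\<close> is
    additive for polynomials over a field, \<open>g\<close> is additive on the whole type, also
    where the division is not exact.\<close>
  define g where "g = poly_fold (\<lambda>j c. w j (c div h ^ j))"
  have w_add: "w j (s + t) = w j s + w j t" for j s t
    unfolding w_def by (rule poly_fold_add) (simp_all add: wscale_add_left)
  have w_0: "w j 0 = 0" for j
    by (simp add: w_def poly_fold_def)
  have w_smult: "w j (smult c t) = wscale c (w j t)" for j c t
    unfolding w_def
    by (simp add: poly_fold_eq_sum [where m = "degree t"] wscale_sum_right wscale_wscale)
  have g_add: "g (a + b) = g a + g b" for a b
    unfolding g_def by (rule poly_fold_add) (simp_all add: poly_div_add_left w_add w_0)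
  have deg: "degree (wscale c a) \<le> degree a" for c and a :: "'a weyl"
    by (simp add: wscale_def degree_smult_le)
  have g_scale: "g (wscale c a) = wscale c (g a)" for c a
    unfolding g_def
    using deg by (simp add: poly_fold_eq_sum [where m = "degree a"] wscale_sum_right w_0)
       (simp add: wscale_def [of _ a] div_smult_left w_smult)
  have w_in: "w j t \<in> weylA h" for j t
    unfolding w_def poly_fold_def by (auto intro!: weylA_intros v)
  have g_in: "g a \<in> weylA h" for a
    unfolding g_def poly_fold_def by (auto intro!: weylA_intros w_in)
  have "g (wbasis h n j) = v n j" for n j
    using \<open>h \<noteq> 0\<close> by (simp add: g_def wbasis_def poly_fold_monom w_0) (simp add: w_def poly_fold_monom)
  then show ?thesis
    unfolding is_lin1_def using g_add g_scale g_in by (intro exI [of _ g]) simp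
qed

section \<open>Cocycles and obstructions\<close>

lemmas weyl_distribs =
  weyl_mult_add_left weyl_mult_add_right weyl.left_diff_distrib weyl.right_diff_distrib
  weyl.mult_minus_left weyl.mult_minus_right

lemma lin1_in: "is_lin1 h g \<Longrightarrow> a \<in> weylA h \<Longrightarrow> g a \<in> weylA h"
  and lin1_add: "is_lin1 h g \<Longrightarrow> a \<in> weylA h \<Longrightarrow> b \<in> weylA h \<Longrightarrow> g (a + b) = g a + g b"
  and lin1_scale: "is_lin1 h g \<Longrightarrow> a \<in> weylA h \<Longrightarrow> g (wscale c a) = wscale c (g a)"
  by (auto simp: is_lin1_def)

lemma lin1_0: "is_lin1 h g \<Longrightarrow> g 0 = 0"
  using lin1_scale [of h g 0 0] by (simp add: weylA_0)

lemma lin1_sum: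
  "is_lin1 h g \<Longrightarrow> (\<And>i. i \<in> S \<Longrightarrow> f i \<in> weylA h) \<Longrightarrow> g (sum f S) = (\<Sum>i\<in>S. g (f i))"
  by (induction S rule: infinite_finite_induct) (auto simp: lin1_0 lin1_add weylA_sum)

lemma wpoly_conv_sum: "wpoly t = (\<Sum>n\<le>degree t. wscale (coeff t n) (wpoly (monom 1 n)))"
proof -
  have "(\<Sum>n\<le>degree t. wscale (coeff t n) (wpoly (monom 1 n))) = wpoly (\<Sum>n\<le>degree t. monom (coeff t n) n)"
    by (simp add: poly_eq_iff wpoly_def wscale_def coeff_sum coeff_pCons coeff_monom split: nat.splits)
       (simp add: if_distrib cong: if_cong)
  then show ?thesis by (simp add: poly_as_sum_of_monoms)
qed

lemma lin1_wpoly_mult_wbasis: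
  assumes "is_lin1 h g"
  shows "g (wpoly t \<odot> wbasis h 0 j) = (\<Sum>n\<le>degree t. wscale (coeff t n) (g (wbasis h n j)))"
proof -
  have "wpoly t \<odot> wbasis h 0 j = (\<Sum>n\<le>degree t. wscale (coeff t n) (wbasis h n j))"
    by (subst wpoly_conv_sum) (simp add: weyl_mult_sum_left weyl_mult_wscale_left flip: wbasis_conv)
  then show ?thesis
    by (simp add: lin1_sum [OF assms] lin1_scale [OF assms] weylA_intros)
qed

lemma cochain2_right: "is_cochain2 h f \<Longrightarrow> a \<in> weylA h \<Longrightarrow> is_lin1 h (f a)"
  by (auto simp: is_cochain2_def)

lemma cochain2_in: "is_cochain2 h f \<Longrightarrow> a \<in> weylA h \<Longrightarrow> b \<in> weylA h \<Longrightarrow> f a b \<in> weylA h"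
  using cochain2_right lin1_in by blast

lemma cochain2I:
  assumes "\<And>a b. a \<in> weylA h \<Longrightarrow> b \<in> weylA h \<Longrightarrow> f a b \<in> weylA h"
    and "\<And>a b c. a \<in> weylA h \<Longrightarrow> b \<in> weylA h \<Longrightarrow> c \<in> weylA h \<Longrightarrow> f (a + b) c = f a c + f b c"
    and "\<And>a b c. a \<in> weylA h \<Longrightarrow> b \<in> weylA h \<Longrightarrow> c \<in> weylA h \<Longrightarrow> f a (b + c) = f a b + f a c"
    and "\<And>r a b. a \<in> weylA h \<Longrightarrow> b \<in> weylA h \<Longrightarrow> f (wscale r a) b = wscale r (f a b)"
    and "\<And>r a b. a \<in> weylA h \<Longrightarrow> b \<in> weylA h \<Longrightarrow> f a (wscale r b) = wscale r (f a b)"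
  shows "is_cochain2 h f"
  using assms by (auto simp: is_cochain2_def is_lin1_def)

lemma cochain2_simps:
  assumes "is_cochain2 h f" "a \<in> weylA h" "b \<in> weylA h" "c \<in> weylA h"
  shows "f (a + b) c = f a c + f b c" "f a (b + c) = f a b + f a c"
    "f (wscale r a) b = wscale r (f a b)" "f a (wscale r b) = wscale r (f a b)"
  using assms by (auto simp: is_cochain2_def is_lin1_def)

text \<open>Fixing the first argument makes the cocycle identity a property of single elements,
  which passes to sums, scalar multiples and products and hence needs checking on generators
  only.\<close>

definition cocycle_at :: "'a::field poly \<Rightarrow> ('a weyl \<Rightarrow> 'a weyl \<Rightarrow> 'a weyl) \<Rightarrow> 'a weyl \<Rightarrow> bool" where
  "cocycle_at h f a \<longleftrightarrow> (\<forall>b\<in>weylA h. \<forall>c\<in>weylA h.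
     a \<odot> f b c - f (a \<odot> b) c + f a (b \<odot> c) - f a b \<odot> c = 0)"

lemma is_cocycle2_iff: "is_cocycle2 h f \<longleftrightarrow> is_cochain2 h f \<and> (\<forall>a\<in>weylA h. cocycle_at h f a)"
  by (auto simp: is_cocycle2_def cocycle_at_def)

lemma cocycle2_cochain2: "is_cocycle2 h f \<Longrightarrow> is_cochain2 h f"
  by (simp add: is_cocycle2_def)

lemma cocycle2_eq:
  assumes "is_cocycle2 h f" "a \<in> weylA h" "b \<in> weylA h" "c \<in> weylA h"
  shows "f (a \<odot> b) c = a \<odot> f b c + f a (b \<odot> c) - f a b \<odot> c"
proof -
  have "a \<odot> f b c - f (a \<odot> b) c + f a (b \<odot> c) - f a b \<odot> c = 0"
    using assms by (simp add: is_cocycle2_def)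
  then show ?thesis by (simp add: algebra_simps)
qed

lemma cocycle_at_mult:
  assumes f: "is_cochain2 h f" and A: "a \<in> weylA h" "b \<in> weylA h"
    and Za: "cocycle_at h f a" and Zb: "cocycle_at h f b"
  shows "cocycle_at h f (a \<odot> b)"
  unfolding cocycle_at_def
proof (intro ballI)
  fix c d assume cd: "c \<in> weylA h" "d \<in> weylA h"
  define Z where "Z a b c = a \<odot> f b c - f (a \<odot> b) c + f a (b \<odot> c) - f a b \<odot> c" for a b c
  have Z0: "Z a b c = 0" "Z a (b \<odot> c) d = 0" "Z a b (c \<odot> d) = 0" "Z b c d = 0"
    using Za Zb A cd by (auto simp: cocycle_at_def Z_def intro: weylA.mult)
  \<comment> \<open>This is d(df) = 0 for the Hochschild differential d, solved for the term with a
    product in the first argument.\<close>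
  have "Z (a \<odot> b) c d = a \<odot> Z b c d + Z a (b \<odot> c) d - Z a b (c \<odot> d) + Z a b c \<odot> d"
    unfolding Z_def by (simp add: weyl_distribs weyl_mult_assoc)
  then show "(a \<odot> b) \<odot> f c d - f ((a \<odot> b) \<odot> c) d + f (a \<odot> b) (c \<odot> d) - f (a \<odot> b) c \<odot> d = 0"
    unfolding Z0 by (simp add: Z_def)
qed

lemma cocycle2_from_generators:
  assumes f: "is_cochain2 h f"
    and "cocycle_at h f (wpoly 1)" "cocycle_at h f wX" "cocycle_at h f (wYhat h)"
  shows "is_cocycle2 h f"
proof -
  have "cocycle_at h f a" if "a \<in> weylA h" for a
    using that
  proof induction
    case (add a b)
    have "(a + b) \<odot> f c d - f ((a + b) \<odot> c) d + f (a + b) (c \<odot> d) - f (a + b) c \<odot> d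
        = (a \<odot> f c d - f (a \<odot> c) d + f a (c \<odot> d) - f a c \<odot> d) +
          (b \<odot> f c d - f (b \<odot> c) d + f b (c \<odot> d) - f b c \<odot> d)"
      if "c \<in> weylA h" "d \<in> weylA h" for c d
      using that add by (simp add: weyl_distribs cochain2_simps [OF f] weylA.mult)
    then show ?case using add by (simp add: cocycle_at_def)
  next
    case (scale a r)
    have "wscale r a \<odot> f c d - f (wscale r a \<odot> c) d + f (wscale r a) (c \<odot> d) - f (wscale r a) c \<odot> d
        = wscale r (a \<odot> f c d - f (a \<odot> c) d + f a (c \<odot> d) - f a c \<odot> d)"
      if "c \<in> weylA h" "d \<in> weylA h" for c d
      using that scale
      by (simp add: weyl_mult_wscale_left cochain2_simps [OF f] weylA.mult wscale_add_right wscale_diff_right)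
    then show ?case using scale by (simp add: cocycle_at_def)
  qed (use assms cocycle_at_mult in auto)
  then show ?thesis using f by (simp add: is_cocycle2_iff)
qed

definition cobd :: "('a::field weyl \<Rightarrow> 'a weyl) \<Rightarrow> 'a weyl \<Rightarrow> 'a weyl \<Rightarrow> 'a weyl" where
  "cobd g a b = a \<odot> g b - g (a \<odot> b) + g a \<odot> b"

lemma is_coboundary2_iff:
  "is_coboundary2 h f \<longleftrightarrow> (\<exists>g. is_lin1 h g \<and> (\<forall>a\<in>weylA h. \<forall>b\<in>weylA h. f a b = cobd g a b))"
  by (simp add: is_coboundary2_def cobd_def)

lemma cobd_cocycle2:
  assumes g: "is_lin1 h g"
  shows "is_cocycle2 h (cobd g)"
proof -
  have "is_cochain2 h (cobd g)"
    by (rule cochain2I)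
       (auto simp: cobd_def weyl_distribs lin1_add [OF g] lin1_scale [OF g] weylA.mult weyl_mult_wscale_left
         weyl_mult_wscale_right wscale_add_right wscale_diff_right algebra_simps intro!: weylA_intros lin1_in [OF g])
  then show ?thesis
    by (simp add: is_cocycle2_def cobd_def weyl_distribs weyl_mult_assoc)
qed

lemma cocycle2_diff:
  assumes "is_cocycle2 h f" "is_cocycle2 h f'"
  shows "is_cocycle2 h (\<lambda>a b. f a b - f' a b)"
proof -
  have 1: "is_cochain2 h f" "is_cochain2 h f'" using assms cocycle2_cochain2 by auto
  then have "is_cochain2 h (\<lambda>a b. f a b - f' a b)"
    by (intro cochain2I) (auto simp: cochain2_simps [OF 1(1)] cochain2_simps [OF 1(2)]
       cochain2_in wscale_diff_right weylA_diff)
  then show ?thesis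
    by (simp add: is_cocycle2_def weyl_distribs weylA.mult
        cocycle2_eq [OF assms(1)] cocycle2_eq [OF assms(2)])
qed

lemma cocycle2_vanish_mult:
  assumes f: "is_cocycle2 h f" and A: "a \<in> weylA h" "b \<in> weylA h" "c \<in> weylA h"
    and "\<And>c. c \<in> weylA h \<Longrightarrow> f a c = 0" "\<And>c. c \<in> weylA h \<Longrightarrow> f b c = 0"
  shows "f (a \<odot> b) c = 0"
  using assms by (simp add: cocycle2_eq [OF f] weylA.mult)

lemma cocycle2_vanish_from_generators:
  assumes f: "is_cocycle2 h f"
    and gens: "\<And>b. b \<in> weylA h \<Longrightarrow> f (wpoly 1) b = 0" "\<And>b. b \<in> weylA h \<Longrightarrow> f wX b = 0"
      "\<And>b. b \<in> weylA h \<Longrightarrow> f (wYhat h) b = 0"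
    and "a \<in> weylA h" "b \<in> weylA h"
  shows "f a b = 0"
  using \<open>a \<in> weylA h\<close> \<open>b \<in> weylA h\<close>
proof (induction arbitrary: b)
  case (mult a a')
  then show ?case using cocycle2_vanish_mult [OF f] by blast
qed (simp_all add: gens cochain2_simps [OF cocycle2_cochain2 [OF f]])

lemma wYhat_wX: "wYhat h \<odot> wX = wX \<odot> wYhat h + wpoly h"
  unfolding wX_def by (simp add: wYhat_comm_wpoly pderiv_pCons flip: one_pCons)

lemma wYhat_wX_mult: "wYhat h \<odot> (wX \<odot> a) = wX \<odot> (wYhat h \<odot> a) + wpoly h \<odot> a"
  by (metis weyl_mult_assoc wYhat_wX weyl_mult_add_left)

text \<open>The uniqueness half of the classification: a cocycle that vanishes on the few products
  used to build the basis vanishes everywhere. The relation \<open>wYhat_wX\<close> carries the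
  vanishing of f(\<open>wYhat h\<close>, _) from h^j y^j to x^n h^j y^j.\<close>

lemma cocycle2_vanish:
  assumes f: "is_cocycle2 h f"
    and f1: "\<And>b. b \<in> weylA h \<Longrightarrow> f (wpoly 1) b = 0"
    and fX: "\<And>b. b \<in> weylA h \<Longrightarrow> f wX b = 0"
    and fY: "\<And>j. f (wYhat h) (wbasis h 0 j) = 0"
    and fYX: "f (wYhat h) wX = 0"
    and "a \<in> weylA h" "b \<in> weylA h"
  shows "f a b = 0"
proof -
  note simps = cochain2_simps [OF cocycle2_cochain2 [OF f]] 
  note eq = cocycle2_eq [OF f]
  have f_wpoly: "f (wpoly t) b = 0" if "b \<in> weylA h" for t b
    using that
  proof (induction t arbitrary: b)
    case 0
    then show ?case using simps(3) [of "wpoly 1" b b 0] by (simp add: weylA_intros)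
  next
    case (pCons c t)
    have "f (wX \<odot> wpoly t) b = 0"
      using pCons fX by (intro cocycle2_vanish_mult [OF f]) (auto intro: weylA_intros)
    then show ?case
      using pCons f1 by (simp add: wpoly_pCons simps weylA_intros)
  qed
  have fY': "f (wYhat h) (wbasis h n j) = 0" for n j
  proof (induction n)
    case (Suc n)
    let ?b = "wbasis h n j"
    \<comment> \<open>The cocycle identity moves x into the first argument; there
      \<open>wYhat h\<close> and x are exchanged, and x is taken out again.\<close>
    have "f (wYhat h) (wX \<odot> ?b) = f (wYhat h \<odot> wX) ?b"
      by (simp add: eq weylA_intros fX fYX)
    also have "\<dots> = f (wX \<odot> wYhat h) ?b"
      by (simp add: wYhat_wX simps f_wpoly weylA_intros)
    also have "\<dots> = 0"
      by (simp add: eq weylA_intros fX Suc)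
    finally show ?case by (simp add: wX_wbasis)
  qed (rule fY)
  have "f (wYhat h) b = 0" if "b \<in> weylA h" for b
    using that by (induction rule: weylA_linear_induct) (simp_all add: fY' simps weylA_intros)
  then show ?thesis
    using cocycle2_vanish_from_generators [OF f f1 fX] assms by blast
qed

text \<open>In the extension with product (a, u)(b, v) = (a b, a v + u b + f(a, b)), the n-th power
  of the lift (x, 0) is (x^n, \<open>power_defect f n\<close>). The value at 0 is negative because
  the unit of the extension is (1, -f(1, 1)).\<close>

primrec power_defect :: "('a::field weyl \<Rightarrow> 'a weyl \<Rightarrow> 'a weyl) \<Rightarrow> nat \<Rightarrow> 'a weyl" where
  "power_defect f 0 = - f (wpoly 1) (wpoly 1)"
| "power_defect f (Suc n) = wX \<odot> power_defect f n + f wX (wpoly (monom 1 n))"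

text \<open>The second component of the defining relation of A, evaluated in the extension at the
  lifts (x, 0) and (\<open>wYhat h\<close>, 0); the sum is that of h evaluated at (x, 0).\<close>

definition obstruction :: "'a::field poly \<Rightarrow> ('a weyl \<Rightarrow> 'a weyl \<Rightarrow> 'a weyl) \<Rightarrow> 'a weyl" where
  "obstruction h f = f (wYhat h) wX - f wX (wYhat h)
     - (\<Sum>n\<le>degree h. wscale (coeff h n) (power_defect f n))"

lemma obstruction_in:
  assumes "is_cochain2 h f"
  shows "obstruction h f \<in> weylA h"
proof -
  have "power_defect f n \<in> weylA h" for n
    by (induction n) (simp_all add: weylA_intros cochain2_in [OF assms])
  then show ?thesis
    by (simp add: obstruction_def weylA_intros cochain2_in [OF assms])
qed

lemma obstruction_add: "obstruction h (\<lambda>a b. f a b + f' a b) = obstruction h f + obstruction h f'"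
proof -
  have "power_defect (\<lambda>a b. f a b + f' a b) n = power_defect f n + power_defect f' n" for n
    by (induction n) (simp_all add: weyl_distribs)
  then show ?thesis
    by (simp add: obstruction_def sum.distrib wscale_add_right)
qed

lemma obstruction_diff: "obstruction h (\<lambda>a b. f a b - f' a b) = obstruction h f - obstruction h f'"
proof -
  have "power_defect (\<lambda>a b. f a b - f' a b) n = power_defect f n - power_defect f' n" for n
    by (induction n) (simp_all add: weyl_distribs)
  then show ?thesis
    by (simp add: obstruction_def sum_subtractf wscale_diff_right)
qed

lemma obstruction_center_mult:
  assumes "z \<in> centerA h"
  shows "obstruction h (\<lambda>a b. z \<odot> f a b) = z \<odot> obstruction h f"
proof -
  have zX: "wX \<odot> (z \<odot> a) = z \<odot> (wX \<odot> a)" for a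
  proof -
    have "wX \<odot> z = z \<odot> wX"
      using assms by (simp add: centerA_def weylA.gen_x)
    then show ?thesis by (metis weyl_mult_assoc)
  qed
  have "power_defect (\<lambda>a b. z \<odot> f a b) n = z \<odot> power_defect f n" for n
    by (induction n) (simp_all add: weyl_distribs zX)
  then show ?thesis
    by (simp add: obstruction_def weyl_distribs weyl_mult_sum_right weyl_mult_wscale_right)
qed

lemma obstruction_cong:
  assumes "\<And>a b. a \<in> weylA h \<Longrightarrow> b \<in> weylA h \<Longrightarrow> f a b = f' a b"
  shows "obstruction h f = obstruction h f'"
proof -
  have "power_defect f n = power_defect f' n" for n
    by (induction n) (simp_all add: assms weylA_intros)
  then show ?thesis
    by (simp add: obstruction_def assms weylA_intros)
qed

lemma obstruction_normalized:
  assumes "\<And>b. b \<in> weylA h \<Longrightarrow> f (wpoly 1) b = 0" "\<And>b. b \<in> weylA h \<Longrightarrow> f wX b = 0"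
  shows "obstruction h f = f (wYhat h) wX"
proof -
  have "power_defect f n = 0" for n
    by (induction n) (simp_all add: assms weylA_intros)
  then show ?thesis
    by (simp add: obstruction_def assms weylA_intros)
qed

definition F_mon :: "'a::field weyl \<Rightarrow> nat \<Rightarrow> 'a weyl" where
  "F_mon \<alpha> n = (\<Sum>l<n. (wpoly (monom 1 l) \<odot> \<alpha>) \<odot> wpoly (monom 1 (n - l - 1)))"

lemma F_map_eq: "F_map \<alpha> g = (\<Sum>s\<le>degree g. wscale (coeff g s) (F_mon \<alpha> s))"
  by (simp add: F_map_def F_mon_def)

lemma F_mon_0 [simp]: "F_mon \<alpha> 0 = 0"
  by (simp add: F_mon_def)

lemma F_mon_Suc: "F_mon \<alpha> (Suc n) = wX \<odot> F_mon \<alpha> n + \<alpha> \<odot> wpoly (monom 1 n)"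
  unfolding F_mon_def sum.lessThan_Suc_shift
  by (simp add: weyl_mult_sum_right wX_weyl_mult_monom flip: weyl_mult_assoc)

lemma F_mon_in: "\<alpha> \<in> weylA h \<Longrightarrow> F_mon \<alpha> n \<in> weylA h"
  unfolding F_mon_def by (auto intro!: weylA_intros)

text \<open>For a coboundary the extension is split by a \<mapsto> (a, -g(a)). The lift (x, 0)
  differs from the split one by (0, g(x)), which changes its n-th power by F of x^n; the remaining
  values of g cancel because g is linear and the relation holds in A.\<close>

lemma obstruction_cobd:
  assumes g: "is_lin1 h g"
  shows "obstruction h (cobd g) = D2 h (g wX) (g (wYhat h))"
proof -
  have "power_defect (cobd g) n = F_mon (g wX) n - g (wpoly (monom 1 n))" for n
  proof (induction n)
    case 0
    then show ?case by (simp add: cobd_def monom_0 flip: one_pCons)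
  next
    case (Suc n)
    then show ?case by (simp add: F_mon_Suc weyl_distribs cobd_def wX_weyl_mult_monom)
  qed
  then have "(\<Sum>n\<le>degree h. wscale (coeff h n) (power_defect (cobd g) n)) =
      F_map (g wX) h - (\<Sum>n\<le>degree h. g (wscale (coeff h n) (wpoly (monom 1 n))))"
    by (simp add: F_map_eq wscale_diff_right sum_subtractf lin1_scale [OF g] weylA_intros)
  also have "\<dots> = F_map (g wX) h - g (wpoly h)"
    using wpoly_conv_sum [of h] by (simp add: lin1_sum [OF g] weylA_intros)
  finally have "obstruction h (cobd g) =
      cobd g (wYhat h) wX - cobd g wX (wYhat h) - F_map (g wX) h + g (wpoly h)"
    by (simp add: obstruction_def)
  then show ?thesis
    by (simp add: cobd_def wYhat_wX lin1_add [OF g] weylA_intros D2_def wcomm_def)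
qed

lemma obstruction_coboundary2:
  assumes "is_coboundary2 h f"
  shows "obstruction h f \<in> imD2 h"
proof -
  obtain g where g: "is_lin1 h g" and "\<forall>a\<in>weylA h. \<forall>b\<in>weylA h. f a b = cobd g a b"
    using assms by (auto simp: is_coboundary2_iff)
  then have "obstruction h f = obstruction h (cobd g)"
    by (intro obstruction_cong) auto
  then show ?thesis
    using lin1_in [OF g weylA.gen_x] lin1_in [OF g weylA.gen_yhat]
    by (auto simp: obstruction_cobd [OF g] imD2_def)
qed

lemma obstruction_in_imD2:
  assumes h: "h \<noteq> 0" and f: "is_cocycle2 h f" and "obstruction h f \<in> imD2 h"
  shows "is_coboundary2 h f"
proof -
  obtain \<alpha> \<beta> where A: "\<alpha> \<in> weylA h" "\<beta> \<in> weylA h" and obs: "obstruction h f = D2 h \<alpha> \<beta>"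
    using assms by (auto simp: imD2_def)
  note f_in = cochain2_in [OF cocycle2_cochain2 [OF f]]
  define t where "t j = of_nat (Suc j) * pderiv h" for j
  \<comment> \<open>\<open>col v j n\<close> is the value of the wanted g at x^n h^j y^j if its
    value at h^j y^j is v: the recursion says that f - \<open>cobd g\<close> vanishes at (x, x^n h^j
    y^j), given g(x) = \<alpha>.\<close>
  define col where "col v j = rec_nat v
    (\<lambda>n r. wX \<odot> r + \<alpha> \<odot> wbasis h n j - f wX (wbasis h n j))" for v j
  \<comment> \<open>The values of g at h^j y^j. The start f(1, 1) is forced by f =
    \<open>cobd g\<close> at (1, 1); the recursion says that f - \<open>cobd g\<close> vanishes at
    (\<open>wYhat h\<close>, h^j y^j), given g(\<open>wYhat h\<close>) = \<beta>. The sum is g at (j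
    + 1) h' h^j y^j and needs column j only.\<close>
  define gs where "gs = rec_nat (f (wpoly 1) (wpoly 1)) (\<lambda>j r.
    wYhat h \<odot> r + \<beta> \<odot> wbasis h 0 j - f (wYhat h) (wbasis h 0 j)
      - (\<Sum>n\<le>degree (t j). wscale (coeff (t j) n) (col r j n)))"
  define v where "v n j = col (gs j) j n" for n j
  have v_0: "v 0 j = gs j" and v_Suc: "v (Suc n) j = wX \<odot> v n j + \<alpha> \<odot> wbasis h n j - f wX (wbasis h n j)"
    for n j by (simp_all add: v_def col_def)
  have gs_0: "gs 0 = f (wpoly 1) (wpoly 1)" 
    and gs_Suc: "gs (Suc j) = wYhat h \<odot> gs j + \<beta> \<odot> wbasis h 0 j - f (wYhat h) (wbasis h 0 j)
      - (\<Sum>n\<le>degree (t j). wscale (coeff (t j) n) (v n j))" for j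
    by (simp_all add: gs_def v_def)
  have v_in': "gs j \<in> weylA h \<Longrightarrow> v n j \<in> weylA h" for n j
    by (induction n) (simp_all add: v_0 v_Suc weylA_intros f_in A)
  have gs_in: "gs j \<in> weylA h" for j
  proof (induction j)
    case (Suc j)
    then show ?case
      using v_in' [OF Suc] by (simp add: gs_Suc weylA_intros f_in A)
  qed (simp add: gs_0 weylA_intros f_in)
  obtain g where g: "is_lin1 h g" and gv: "\<And>n j. g (wbasis h n j) = v n j"
    using weylA_linear_extension [OF h, of v] v_in' [OF gs_in] by blast
  have g_1: "g (wpoly 1) = f (wpoly 1) (wpoly 1)"
    using gv [of 0 0] by (simp add: wbasis_0_0 v_0 gs_0)
  have f_1: "f a (wpoly 1) = a \<odot> f (wpoly 1) (wpoly 1)" if "a \<in> weylA h" for a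
    using cocycle2_eq [OF f that, of "wpoly 1" "wpoly 1"] by (simp add: weylA_intros)
  have f_1': "f (wpoly 1) a = f (wpoly 1) (wpoly 1) \<odot> a" if "a \<in> weylA h" for a
    using cocycle2_eq [OF f _ _ that, of "wpoly 1" "wpoly 1"] by (simp add: weylA_intros)
  have Y_basis: "wYhat h \<odot> wbasis h 0 j = wbasis h 0 (Suc j) + wpoly (t j) \<odot> wbasis h 0 j" for j
    by (simp add: wYhat_wbasis t_def)
  have g_Y_basis: "g (wYhat h \<odot> wbasis h 0 j) =
      wYhat h \<odot> g (wbasis h 0 j) + \<beta> \<odot> wbasis h 0 j - f (wYhat h) (wbasis h 0 j)" for j
    using lin1_wpoly_mult_wbasis [OF g, of "t j" j]
    by (simp add: Y_basis lin1_add [OF g] weylA_intros gv v_0 gs_Suc)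
  have g_X: "g wX = \<alpha>"
  proof -
    have "g wX = g (wX \<odot> wbasis h 0 0)" by (simp add: wbasis_0_0)
    also have "\<dots> = wX \<odot> gs 0 + \<alpha> - f wX (wpoly 1)"
      unfolding wX_wbasis gv v_Suc v_0 by (simp add: wbasis_0_0)
    finally show ?thesis by (simp add: gs_0 f_1 [of wX] weylA_intros)
  qed
  have g_Y: "g (wYhat h) = \<beta>"
    using g_Y_basis [of 0] by (simp add: wbasis_0_0 g_1 f_1 [of "wYhat h"] weylA_intros)
  define \<Delta> where "\<Delta> a b = f a b - cobd g a b" for a b
  have \<Delta>: "is_cocycle2 h \<Delta>"
    using cocycle2_diff [OF f cobd_cocycle2 [OF g]] by (simp add: \<Delta>_def [abs_def])
  note \<Delta>_simps = cochain2_simps [OF cocycle2_cochain2 [OF \<Delta>]]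
  have \<Delta>_1: "\<Delta> (wpoly 1) b = 0" if "b \<in> weylA h" for b
    using that by (simp add: \<Delta>_def cobd_def g_1 f_1' [of b])
  have \<Delta>_X: "\<Delta> wX b = 0" if "b \<in> weylA h" for b
    using that
  proof (induction rule: weylA_linear_induct)
    case (basis n j)
    then show ?case by (simp add: \<Delta>_def cobd_def g_X wX_wbasis gv v_Suc)
  qed (simp_all add: \<Delta>_simps weylA_intros)
  have \<Delta>_Y: "\<Delta> (wYhat h) (wbasis h 0 j) = 0" for j
    by (simp add: \<Delta>_def cobd_def g_Y g_Y_basis)
  \<comment> \<open>The last condition of \<open>cocycle2_vanish\<close> is not achieved by the
    choice of g; it is where the hypothesis on the obstruction enters.\<close>
  have "obstruction h \<Delta> = 0"
    by (simp add: \<Delta>_def [abs_def] obstruction_diff obstruction_cobd [OF g] g_X g_Y obs)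
  then have \<Delta>_YX: "\<Delta> (wYhat h) wX = 0"
    using obstruction_normalized [of h \<Delta>] \<Delta>_1 \<Delta>_X by simp
  have "f a b = cobd g a b" if "a \<in> weylA h" "b \<in> weylA h" for a b
    using cocycle2_vanish [OF \<Delta> \<Delta>_1 \<Delta>_X \<Delta>_Y \<Delta>_YX that] by (simp add: \<Delta>_def)
  then show ?thesis using g by (auto simp: is_coboundary2_iff)
qed

lemma coboundary2_iff_obstruction:
  assumes "h \<noteq> 0" "is_cocycle2 h f"
  shows "is_coboundary2 h f \<longleftrightarrow> obstruction h f \<in> imD2 h"
  using assms obstruction_coboundary2 obstruction_in_imD2 by blast

text \<open>With f(1, _) = f(x, _) = 0 a cocycle is determined by \<eta> = f(\<open>wYhat h\<close>,
  _). The relation of A demands \<eta>(x b) = x \<eta>(b) + u b, where u = \<eta>(x) is the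
  obstruction. Conversely, such an \<eta> is chosen and f is built from it along the basis in the
  first argument.\<close>

lemma obstruction_surj:
  assumes h: "h \<noteq> 0" and u: "u \<in> weylA h"
  shows "\<exists>f. is_cocycle2 h f \<and> obstruction h f = u"
proof -
  define t where "t j = of_nat (Suc j) * pderiv h" for j
  \<comment> \<open>The rule for \<eta>(x b) leaves the values at h^j y^j free; taking them to be 0
    gives this formula.\<close>
  obtain \<eta> where \<eta>: "is_lin1 h \<eta>" and \<eta>_basis: "\<And>n j. \<eta> (wbasis h n j) = F_mon u n \<odot> wbasis h 0 j"
    using weylA_linear_extension [OF h, of "\<lambda>n j. F_mon u n \<odot> wbasis h 0 j"] F_mon_in [OF u]
    by (auto intro: weylA_intros)
  have \<eta>_X: "\<eta> (wX \<odot> b) = wX \<odot> \<eta> b + u \<odot> b" if "b \<in> weylA h" for b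
    using that
  proof (induction rule: weylA_linear_induct)
    case (basis n j)
    show ?case
      by (simp add: wX_wbasis \<eta>_basis F_mon_Suc weyl_distribs weyl_mult_assoc flip: wbasis_conv)
  qed (simp_all add: lin1_add [OF \<eta>] lin1_scale [OF \<eta>] weylA_intros weyl_distribs
        weyl_mult_wscale_right wscale_add_right)
  have \<eta>_1: "\<eta> (wpoly 1) = 0"
    using \<eta>_basis [of 0 0] by (simp add: wbasis_0_0)
  \<comment> \<open>\<open>ths j b\<close> will be f(h^j y^j, b). The recursion is the cocycle
    identity at (\<open>wYhat h\<close>, h^j y^j, b) combined with \<open>wYhat_wbasis\<close>; the
    term \<eta>(h^j y^j) b is absent because it is 0.\<close>
  define ths where "ths = rec_nat (\<lambda>b. 0)
    (\<lambda>j r b. wYhat h \<odot> r b - wpoly (t j) \<odot> r b + \<eta> (wbasis h 0 j \<odot> b))"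
  have ths_0: "ths 0 b = 0"
    and ths_Suc: "ths (Suc j) b = wYhat h \<odot> ths j b - wpoly (t j) \<odot> ths j b + \<eta> (wbasis h 0 j \<odot> b)"
    for j b by (simp_all add: ths_def)
  have ths: "is_lin1 h (ths j)" for j
  proof (induction j)
    case (Suc j)
    then show ?case
      unfolding is_lin1_def
      by (auto simp: ths_Suc lin1_add [OF \<eta>] lin1_scale [OF \<eta>] lin1_in [OF \<eta>] weyl_distribs
          weylA_intros weyl_mult_wscale_right wscale_add_right wscale_diff_right)
  qed (simp add: is_lin1_def ths_0 weylA_0)
  \<comment> \<open>Extension in the first argument, linear over F[x] from the left: since f(x, _) =
    0, this linearity is the cocycle identity at x.\<close>
  have "\<exists>T. is_lin1 h T \<and> (\<forall>n j. T (wbasis h n j) = wpoly (monom 1 n) \<odot> ths j b)"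
    if "b \<in> weylA h" for b
    using that by (intro weylA_linear_extension h weylA_intros lin1_in [OF ths])
  then obtain T where T: "\<And>b. b \<in> weylA h \<Longrightarrow> is_lin1 h (T b)"
    and T_basis: "\<And>b n j. b \<in> weylA h \<Longrightarrow> T b (wbasis h n j) = wpoly (monom 1 n) \<odot> ths j b"
    by metis
  define f where "f a b = T b a" for a b
  have f: "is_cochain2 h f"
  proof (rule cochain2I)
    fix a b c assume "a \<in> weylA h" "b \<in> weylA h" "c \<in> weylA h"
    then show "f a (b + c) = f a b + f a c"
    proof (induction rule: weylA_linear_induct)
      case (basis n j)
      then show ?case by (simp add: f_def T_basis weylA_intros lin1_add [OF ths] weyl_distribs)
    qed (simp_all add: f_def lin1_add [OF T] lin1_scale [OF T] weylA_intros wscale_add_right)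
  next
    fix r a b assume "a \<in> weylA h" "b \<in> weylA h"
    then show "f a (wscale r b) = wscale r (f a b)"
    proof (induction rule: weylA_linear_induct)
      case (basis n j)
      then show ?case by (simp add: f_def T_basis weylA_intros lin1_scale [OF ths] weyl_mult_wscale_right)
    qed (simp_all add: f_def lin1_add [OF T] lin1_scale [OF T] weylA_intros wscale_add_right wscale_wscale mult.commute)
  qed (simp_all add: f_def lin1_in [OF T] lin1_add [OF T] lin1_scale [OF T])
  note f_simps = cochain2_simps [OF f]
  have f_1: "f (wpoly 1) b = 0" if "b \<in> weylA h" for b
    using T_basis [OF that, of 0 0] by (simp add: f_def wbasis_0_0 ths_0)
  have f_X_mult: "f (wX \<odot> a) b = wX \<odot> f a b" if "a \<in> weylA h" "b \<in> weylA h" for a b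
    using that
  proof (induction rule: weylA_linear_induct)
    case (basis n j)
    then show ?case
      unfolding wX_wbasis by (simp add: f_def T_basis flip: wX_weyl_mult_monom weyl_mult_assoc)
  qed (simp_all add: f_simps weylA_intros weyl_distribs weyl_mult_wscale_right)
  have f_X: "f wX b = 0" if "b \<in> weylA h" for b
    using f_X_mult [of "wpoly 1" b] that by (simp add: weylA_intros f_1)
  have f_wpoly_mult: "f (wpoly s \<odot> a) b = wpoly s \<odot> f a b" if "a \<in> weylA h" "b \<in> weylA h" for s a b
  proof (induction s)
    case 0
    show ?case using f_simps(3) [of a b b 0] that by simp
  next
    case (pCons c s)
    then show ?case
      using that by (simp add: wpoly_pCons weyl_distribs weyl_mult_assoc f_simps weylA_intros f_X_mult weyl_mult_wscale_left)
  qed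
  \<comment> \<open>The cocycle identity at \<open>wYhat h\<close>. It holds for n = 0 by
    construction. From n to n + 1 the generator is moved past x, and the two terms u a b produced by
    the rule for \<eta>(x b) cancel.\<close>
  have f_Y_basis: "f (wYhat h \<odot> wbasis h n j) b =
      wYhat h \<odot> f (wbasis h n j) b + \<eta> (wbasis h n j \<odot> b) - \<eta> (wbasis h n j) \<odot> b"
    if b: "b \<in> weylA h" for n j b
  proof (induction n)
    case 0
    have "f (wbasis h 0 j) b = ths j b" for j
      using b by (simp add: f_def T_basis)
    moreover have "wYhat h \<odot> wbasis h 0 j = wbasis h 0 (Suc j) + wpoly (t j) \<odot> wbasis h 0 j"
      by (simp add: wYhat_wbasis t_def)
    ultimately show ?case
      using b by (simp add: f_simps weylA_intros f_wpoly_mult ths_Suc \<eta>_basis)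
  next
    case (Suc n)
    let ?a = "wbasis h n j"
    have "f (wYhat h \<odot> (wX \<odot> ?a)) b = wX \<odot> f (wYhat h \<odot> ?a) b + wpoly h \<odot> f ?a b"
      using b by (simp add: wYhat_wX_mult f_simps weylA_intros f_X_mult f_wpoly_mult)
    also have "\<dots> = wYhat h \<odot> f (wX \<odot> ?a) b + \<eta> (wX \<odot> ?a \<odot> b) - \<eta> (wX \<odot> ?a) \<odot> b"
      using b by (simp add: Suc f_X_mult \<eta>_X weylA_intros weyl_distribs weyl_mult_assoc wYhat_wX_mult)
    finally show ?case by (simp add: wX_wbasis)
  qed
  have f_Y_mult: "f (wYhat h \<odot> a) b = wYhat h \<odot> f a b + \<eta> (a \<odot> b) - \<eta> a \<odot> b"
    if "a \<in> weylA h" "b \<in> weylA h" for a b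
    using that
  proof (induction rule: weylA_linear_induct)
    case (basis n j)
    then show ?case by (rule f_Y_basis)
  qed (simp_all add: f_simps weylA_intros weyl_distribs weyl_mult_wscale_right weyl_mult_wscale_left
       lin1_add [OF \<eta>] lin1_scale [OF \<eta>] wscale_add_right wscale_diff_right)
  have f_Y: "f (wYhat h) b = \<eta> b" if "b \<in> weylA h" for b
    using f_Y_mult [of "wpoly 1" b] that by (simp add: weylA_intros f_1 \<eta>_1)
  have "is_cocycle2 h f"
    using f by (rule cocycle2_from_generators)
       (simp_all add: cocycle_at_def f_1 f_X f_Y f_X_mult f_Y_mult weylA_intros)
  moreover have "obstruction h f = u"
    using \<eta>_X [of "wpoly 1"] by (simp add: obstruction_normalized f_1 f_X f_Y weylA_intros \<eta>_1)
  ultimately show ?thesis by blast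
qed

section \<open>The image of \<open>D\<^sub>2\<close>\<close>

lemma wcomm_wX: "wcomm a wX = pderiv a"
  by (simp add: wcomm_def weyl_mult_wX)

lemma pderiv_wpoly_mult: "pderiv (wpoly t \<odot> a) = wpoly t \<odot> pderiv a"
  by (simp add: wpoly_weyl_mult pderiv_smult)

lemma pderiv_mult_wpoly: "pderiv (a \<odot> wpoly t) = pderiv a \<odot> wpoly t"
proof -
  have "wpoly t \<odot> wX = wX \<odot> wpoly t"
    by (simp add: wX_def mult.commute flip: wpoly_mult)
  then have "wcomm (a \<odot> wpoly t) wX = wcomm a wX \<odot> wpoly t"
    by (simp add: wcomm_def weyl_distribs weyl_mult_assoc)
  then show ?thesis by (simp add: wcomm_wX)
qed

lemma weyl_mult_wY: "a \<odot> wY = pCons 0 a"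
proof (induction a rule: poly_monom_induct)
  case (monom g j)
  have *: "(ymul ^^ j) (wY :: 'b :: field weyl) = monom 1 (Suc j)" for j
    by (induction j) (simp_all add: wY_def ymul_monom)
  show ?case
    unfolding weyl_mult_monom_left * by (simp add: smult_monom monom_Suc)
qed (simp_all add: weyl_distribs)

lemma pderiv_mult_wY: "pderiv (a \<odot> wY) = pderiv a \<odot> wY + a"
  by (simp add: weyl_mult_wY pderiv_pCons)

text \<open>Although y itself need not lie in A, differentiation lowers the degree in y and keeps
  the power of h, so that the lost y may be put back.\<close>

lemma pderiv_mult_wY_in:
  assumes "a \<in> weylA h"
  shows "pderiv a \<odot> wY \<in> weylA h"
  unfolding weylA_iff
proof
  show "h ^ j dvd coeff (pderiv a \<odot> wY) j" for j
    using assms by (cases j) (simp_all add: weyl_mult_wY weylA_iff coeff_pderiv dvd_mult del: power_Suc)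
qed

section \<open>Computation modulo the commutators [A, x]\<close>

context
  fixes h :: "'a::field poly"
begin

text \<open>This is [A, x] by \<open>wcomm_wX\<close>, the contribution of \<beta> to the image of
  \<open>D2\<close>.\<close>

abbreviation "dA \<equiv> pderiv ` weylA h"

lemma dA_0: "0 \<in> dA"
  using imageI [OF weylA_0, of pderiv] by simp

lemma dA_add: "a \<in> dA \<Longrightarrow> b \<in> dA \<Longrightarrow> a + b \<in> dA"
  by (auto simp: pderiv_add [symmetric] intro!: imageI weylA.add)

lemma dA_diff: "a \<in> dA \<Longrightarrow> b \<in> dA \<Longrightarrow> a - b \<in> dA"
  by (auto simp: pderiv_diff [symmetric] intro!: imageI weylA_diff)

lemma dA_wpoly_mult: "a \<in> dA \<Longrightarrow> wpoly t \<odot> a \<in> dA"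
  by (auto simp: pderiv_wpoly_mult [symmetric] intro!: imageI weylA.mult wpoly_in_weylA)

lemma dA_wscale: "a \<in> dA \<Longrightarrow> wscale c a \<in> dA"
  by (simp add: wscale_conv_weyl_mult dA_wpoly_mult)

lemma dA_sum: "(\<And>i. i \<in> S \<Longrightarrow> f i \<in> dA) \<Longrightarrow> sum f S \<in> dA"
  by (induction S rule: infinite_finite_induct) (auto simp: dA_0 simp del: image_iff intro!: dA_add)

text \<open>Induction along t with [a, x t] = x [a, t] + [a, x] t, where [a, x] t =
  [a t, x].\<close>

lemma commutator_wpoly_in_dA:
  assumes a: "a \<in> weylA h"
  shows "a \<odot> wpoly t - wpoly t \<odot> a \<in> dA"
proof (induction t)
  case (pCons c t)
  have "a \<odot> wpoly (pCons c t) - wpoly (pCons c t) \<odot> a =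
      wX \<odot> (a \<odot> wpoly t - wpoly t \<odot> a) + pderiv (a \<odot> wpoly t)"
    unfolding pderiv_mult_wpoly
    by (simp add: wpoly_pCons weyl_distribs weyl_mult_wscale_left weyl_mult_wscale_right
        weyl_mult_wX weyl_mult_assoc flip: weyl_mult_assoc [of a wX])
  moreover have "pderiv (a \<odot> wpoly t) \<in> dA"
    by (intro imageI weylA.mult a wpoly_in_weylA)
  ultimately show ?case
    using pCons by (auto simp: wX_def simp del: image_iff intro!: dA_add dA_wpoly_mult)
qed (simp add: dA_0)

text \<open>The first-order term of [a, t] is t' [a, x]. The error arising in the induction is a
  second y-derivative e'' of an element e of A, and e'' y = (e' y - e)' is harmless because e' y
  lies in A.\<close>

lemma commutator_wpoly_wY_in_dA:
  assumes a: "a \<in> weylA h"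
  shows "(wpoly t \<odot> a - a \<odot> wpoly t) \<odot> wY + wpoly (pderiv t) \<odot> (pderiv a \<odot> wY) \<in> dA" (is "?R t \<in> _")
proof (induction t)
  case (pCons c t)
  have "?R (pCons c t) = wX \<odot> ?R t - pderiv (a \<odot> wpoly t - wpoly t \<odot> a) \<odot> wY"
  proof -
    have "wpoly (pderiv (pCons c t)) = wpoly t + wX \<odot> wpoly (pderiv t)"
      by (simp add: pderiv_pCons wpoly_add wpoly_pCons)
    then show ?thesis
      unfolding pderiv_diff pderiv_mult_wpoly pderiv_wpoly_mult
      by (simp add: wpoly_pCons weyl_distribs weyl_mult_wscale_left weyl_mult_wscale_right
          weyl_mult_wX weyl_mult_assoc flip: weyl_mult_assoc [of a wX])
  qed
  moreover obtain e where e: "e \<in> weylA h" "a \<odot> wpoly t - wpoly t \<odot> a = pderiv e"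
    using commutator_wpoly_in_dA [OF a] by auto
  moreover have "pderiv (pderiv e) \<odot> wY = pderiv (pderiv e \<odot> wY - e)"
    by (simp add: pderiv_diff pderiv_mult_wY)
  moreover have "pderiv (pderiv e \<odot> wY - e) \<in> dA"
    by (intro imageI weylA_diff pderiv_mult_wY_in e)
  ultimately show ?case
    using pCons by (auto simp: wX_def simp del: image_iff intro!: dA_diff dA_wpoly_mult)
qed (simp add: dA_0)

text \<open>Modulo \<open>dA\<close> every power of x may be moved to the left of a, which turns F
  into multiplication by the derivative.\<close>

lemma F_mon_mod_dA:
  assumes a: "a \<in> weylA h"
  shows "F_mon a n - wpoly (pderiv (monom 1 n)) \<odot> a \<in> dA"
proof (induction n)
  case (Suc n)
  have "wpoly (pderiv (monom 1 (Suc n) :: 'a poly)) = wX \<odot> wpoly (pderiv (monom 1 n)) + wpoly (monom 1 n)"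
    by (simp add: monom_Suc [of _ n] pderiv_pCons wpoly_add wpoly_pCons add.commute)
  then have "F_mon a (Suc n) - wpoly (pderiv (monom 1 (Suc n))) \<odot> a =
      wX \<odot> (F_mon a n - wpoly (pderiv (monom 1 n)) \<odot> a) + (a \<odot> wpoly (monom 1 n) - wpoly (monom 1 n) \<odot> a)"
    by (simp add: F_mon_Suc weyl_distribs weyl_mult_assoc)
  then show ?case
    using Suc commutator_wpoly_in_dA [OF a]
    by (auto simp: wX_def simp del: image_iff intro!: dA_add dA_wpoly_mult)
qed (simp add: dA_0)

lemma F_map_mod_dA:
  assumes a: "a \<in> weylA h"
  shows "F_map a g - wpoly (pderiv g) \<odot> a \<in> dA"
proof -
  have "wpoly (pderiv g) = (\<Sum>s\<le>degree g. wscale (coeff g s) (wpoly (pderiv (monom 1 s))))"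
  proof -
    have "pderiv (sum f S) = (\<Sum>i\<in>S. pderiv (f i))" for f :: "nat \<Rightarrow> 'a poly" and S
      by (induction S rule: infinite_finite_induct) (simp_all add: pderiv_add)
    moreover have "wpoly (sum f S) = (\<Sum>i\<in>S. wpoly (f i))" for f :: "nat \<Rightarrow> 'a poly" and S
      by (induction S rule: infinite_finite_induct) (simp_all add: wpoly_add)
    moreover have "g = (\<Sum>s\<le>degree g. smult (coeff g s) (monom 1 s))"
      by (simp add: smult_monom poly_as_sum_of_monoms)
    ultimately have "wpoly (pderiv g) = (\<Sum>s\<le>degree g. wpoly (pderiv (smult (coeff g s) (monom 1 s))))"
      by metis
    then show ?thesis by (simp only: pderiv_smult wpoly_smult)
  qed
  then have "F_map a g - wpoly (pderiv g) \<odot> a =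
      (\<Sum>s\<le>degree g. wscale (coeff g s) (F_mon a s - wpoly (pderiv (monom 1 s)) \<odot> a))"
    by (simp add: F_map_eq weyl_mult_sum_left wscale_diff_right sum_subtractf weyl_mult_wscale_left)
  then show ?thesis
    using F_mon_mod_dA [OF a] by (simp add: dA_sum dA_wscale del: image_iff)
qed

end

text \<open>In terms of \<open>c = t h\<^sup>j\<close>, the product \<open>\<kappa>(t) h\<^sup>j\<close> is \<open>h c' - (j + 1) h' c\<close>, which needs no division
  by \<open>h\<^sup>j\<close>.\<close>

definition kappa_weyl :: "'a::field poly \<Rightarrow> 'a weyl \<Rightarrow> 'a weyl" where
  "kappa_weyl h a = smult h (cderiv a) - smult (pderiv h) (pCons 0 (pderiv a) + a)"

lemma coeff_kappa_weyl:
  assumes "coeff a j = t * h ^ j"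
  shows "coeff (kappa_weyl h a) j = kappa h t * h ^ j"
proof -
  have "coeff (kappa_weyl h a) j = h * pderiv (t * h ^ j) - pderiv h * (of_nat (Suc j) * (t * h ^ j))"
    using assms by (cases j) (simp_all add: kappa_weyl_def coeff_pderiv algebra_simps del: power_Suc)
  also have "h * pderiv (t * h ^ j) = h * pderiv t * h ^ j + of_nat j * pderiv h * t * h ^ j"
  proof -
    have "h * pderiv (h ^ j) = of_nat j * pderiv h * h ^ j"
    proof (cases j)
      case (Suc i)
      show ?thesis unfolding Suc pderiv_power_Suc by (simp add: of_nat_poly mult_ac)
    qed simp
    then show ?thesis by (simp add: pderiv_mult algebra_simps)
  qed
  finally show ?thesis by (simp add: kappa_def algebra_simps)
qed

text \<open>Writing \<open>wYhat h\<close> as h y + h' splits the commutator; the pieces left over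
  after removing \<open>kappa_weyl h a\<close> are covered by the three preceding
  congruences.\<close>

lemma D2_mod_dA:
  assumes a: "a \<in> weylA h"
  shows "wcomm (wYhat h) a - F_map a h - kappa_weyl h a \<in> pderiv ` weylA h"
proof -
  have Yh: "wYhat h = wpoly h \<odot> wY + wpoly (pderiv h)"
    by (simp add: wYhat_eq wY_def wpoly_weyl_mult smult_monom)
  have Y: "wY \<odot> a = a \<odot> wY + cderiv a"
    by (simp add: wY_weyl_mult ymul_def weyl_mult_wY)
  have "kappa_weyl h a = wpoly h \<odot> cderiv a - wpoly (pderiv h) \<odot> (pderiv a \<odot> wY) - wpoly (pderiv h) \<odot> a"
    by (simp add: kappa_weyl_def wpoly_weyl_mult weyl_mult_wY smult_add_right)
  then have "wcomm (wYhat h) a - F_map a h - kappa_weyl h a =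
      ((wpoly h \<odot> a - a \<odot> wpoly h) \<odot> wY + wpoly (pderiv h) \<odot> (pderiv a \<odot> wY))
      - (a \<odot> wpoly (pderiv h) - wpoly (pderiv h) \<odot> a) - (F_map a h - wpoly (pderiv h) \<odot> a)"
    by (simp add: wcomm_def Yh weyl_distribs weyl_mult_assoc Y)
  then show ?thesis
    by (simp only:) (intro dA_diff commutator_wpoly_wY_in_dA commutator_wpoly_in_dA F_map_mod_dA a)
qed

text \<open>The error of \<open>D2_mod_dA\<close> lies in [A, x] and is absorbed into
  \<beta>.\<close>

lemma imD2_eq: "imD2 h = {m + kappa_weyl h a | m a. m \<in> pderiv ` weylA h \<and> a \<in> weylA h}"
proof (intro set_eqI iffI)
  fix w assume "w \<in> imD2 h"
  then obtain a b where ab: "a \<in> weylA h" "b \<in> weylA h" and w: "w = D2 h a b"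
    by (auto simp: imD2_def)
  have "w = (pderiv b + (wcomm (wYhat h) a - F_map a h - kappa_weyl h a)) + kappa_weyl h a"
    by (simp add: w D2_def wcomm_wX)
  moreover have "pderiv b + (wcomm (wYhat h) a - F_map a h - kappa_weyl h a) \<in> pderiv ` weylA h"
    by (intro dA_add D2_mod_dA imageI ab)
  ultimately show "w \<in> {m + kappa_weyl h a | m a. m \<in> pderiv ` weylA h \<and> a \<in> weylA h}"
    using ab by blast
next
  fix w assume "w \<in> {m + kappa_weyl h a | m a. m \<in> pderiv ` weylA h \<and> a \<in> weylA h}"
  then obtain m a where ma: "m \<in> pderiv ` weylA h" "a \<in> weylA h" and w: "w = m + kappa_weyl h a"
    by blast
  have "m - (wcomm (wYhat h) a - F_map a h - kappa_weyl h a) \<in> pderiv ` weylA h"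
    by (intro dA_diff D2_mod_dA ma)
  then obtain b where "b \<in> weylA h" "pderiv b = m - (wcomm (wYhat h) a - F_map a h - kappa_weyl h a)"
    by (metis imageE)
  then have "w = D2 h a b" "b \<in> weylA h"
    by (simp_all add: D2_def wcomm_wX w)
  then show "w \<in> imD2 h" using ma by (auto simp: imD2_def)
qed

lemma kappa_add: "kappa h (s + t) = kappa h s + kappa h t"
  by (simp add: kappa_def pderiv_add algebra_simps)

lemma kappa_0 [simp]: "kappa h 0 = 0"
  by (simp add: kappa_def)

lemma kappa_mult: "pderiv s = 0 \<Longrightarrow> kappa h (s * t) = s * kappa h t"
  by (simp add: kappa_def pderiv_mult algebra_simps)

lemma gcd_dvd_kappa: "gcd h (pderiv h) dvd kappa h t" for h :: "'a::field_gcd poly"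
  by (simp add: kappa_def)

lemma cderiv_smult: "cderiv (smult g b) = smult g (cderiv b) + smult (pderiv g) b"
  by (simp add: poly_eq_iff [of "cderiv _"] pderiv_mult mult.commute)

lemma poly_of_coeffs:
  fixes v :: "nat \<Rightarrow> 'b::comm_monoid_add"
  shows "coeff (\<Sum>i\<le>n. monom (v i) i) j = (if j \<le> n then v j else 0)"
  by (simp add: coeff_sum)

text \<open>Membership in F[x][y^p], which in characteristic p is the kernel of
  \<open>pderiv\<close>, that is, the centralizer of x in the Weyl algebra.\<close>

definition p_supported :: "nat \<Rightarrow> 'a::field weyl \<Rightarrow> bool" where
  "p_supported p c \<longleftrightarrow> (\<forall>j. \<not> p dvd j \<longrightarrow> coeff c j = 0)"

definition residue_part :: "nat \<Rightarrow> nat set \<Rightarrow> 'a::field weyl \<Rightarrow> 'a weyl" where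
  "residue_part p R a = (\<Sum>i\<le>degree a. monom (if i mod p \<in> R then coeff a i else 0) i)"

lemma coeff_residue_part [simp]: "coeff (residue_part p R a) i = (if i mod p \<in> R then coeff a i else 0)"
  by (simp add: residue_part_def poly_of_coeffs coeff_eq_0)

section \<open>Coefficientwise description of the image in characteristic p\<close>

context
  fixes h :: "'a::field_gcd poly" and p :: nat
  assumes char: "CHAR('a) = p" and p_pos: "p > 0" and h: "h \<noteq> 0"
begin

lemma prime_p: "prime p"
  using char p_pos prime_CHAR_semidom [where ?'a = 'a] by simp

lemma of_nat_eq_0: "(of_nat n :: 'a) = 0 \<longleftrightarrow> p dvd n"
  by (simp add: of_nat_eq_0_iff_char_dvd char)

lemma of_nat_poly_eq_0: "(of_nat n :: 'a poly) = 0 \<longleftrightarrow> p dvd n"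
  by (simp add: of_nat_poly of_nat_eq_0)

text \<open>Coefficient j of a derivative is j + 1 times coefficient j + 1 of the original, which
  gives both conditions; conversely, integrate termwise in y.\<close>

lemma pderiv_weylA_iff:
  "m \<in> pderiv ` weylA h \<longleftrightarrow> (\<forall>j. h ^ Suc j dvd coeff m j \<and> (p dvd Suc j \<longrightarrow> coeff m j = 0))"
  (is "_ \<longleftrightarrow> ?R")
proof
  assume "m \<in> pderiv ` weylA h"
  then obtain a where a: "a \<in> weylA h" and m: "m = pderiv a" by blast
  show ?R
  proof (intro allI conjI impI)
    fix j
    show "h ^ Suc j dvd coeff m j"
      using a unfolding weylA_iff m coeff_pderiv by (metis dvd_mult)
    show "coeff m j = 0" if "p dvd Suc j"
      using that unfolding m coeff_pderiv of_nat_poly_eq_0 [symmetric] by simp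
  qed
next
  assume R: ?R
  \<comment> \<open>Termwise antiderivative. Where p divides j + 1 the factor is
    \<open>inverse 0 = 0\<close>, which is harmless as coefficient j of \<open>m\<close> vanishes
    there.\<close>
  define a where "a = pCons 0 (\<Sum>j\<le>degree m. monom (smult (inverse (of_nat (Suc j))) (coeff m j)) j)"
  have coeff_a: "coeff a (Suc j) = smult (inverse (of_nat (Suc j))) (coeff m j)" for j
    by (simp add: a_def poly_of_coeffs coeff_eq_0 del: of_nat_Suc)
  have "h ^ j dvd coeff a j" for j
  proof (cases j)
    case (Suc i)
    then show ?thesis using R by (simp add: coeff_a dvd_smult del: of_nat_Suc power_Suc)
  qed simp
  moreover have "coeff (pderiv a) j = coeff m j" for j
  proof (cases "p dvd Suc j")
    case True
    then have "(of_nat (Suc j) :: 'a) = 0" by (simp add: of_nat_eq_0 del: of_nat_Suc)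
    with True R show ?thesis by (simp add: coeff_pderiv coeff_a del: of_nat_Suc)
  next
    case False
    then have "(of_nat (Suc j) :: 'a) \<noteq> 0" by (simp add: of_nat_eq_0 del: of_nat_Suc)
    then show ?thesis by (simp add: coeff_pderiv coeff_a of_nat_poly del: of_nat_Suc)
  qed
  ultimately show "m \<in> pderiv ` weylA h"
    by (metis weylA_iff image_eqI poly_eqI)
qed

text \<open>In degrees \<open>j\<close> with \<open>p\<close> not dividing \<open>j + 1\<close> both \<open>h\<^sup>j\<^sup>+\<^sup>1\<close> and, up to that,
  \<open>h' h\<^sup>j\<close> are available, so Bezout gives the gcd; in the remaining degrees only
  \<^const>\<open>kappa\<close> contributes.\<close>

lemma imD2_iff:
  "w \<in> imD2 h \<longleftrightarrow> (\<forall>j. if p dvd Suc j then \<exists>t. coeff w j = kappa h t * h ^ j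
     else gcd h (pderiv h) * h ^ j dvd coeff w j)" (is "_ \<longleftrightarrow> (\<forall>j. ?R j)")
proof
  assume "w \<in> imD2 h"
  then obtain m a where m: "m \<in> pderiv ` weylA h" and a: "a \<in> weylA h" and w: "w = m + kappa_weyl h a"
    by (auto simp: imD2_eq)
  show "\<forall>j. ?R j"
  proof
    fix j
    obtain t where "coeff a j = t * h ^ j" using a by (metis weylA_iff dvdE mult.commute)
    then have *: "coeff (kappa_weyl h a) j = kappa h t * h ^ j" by (rule coeff_kappa_weyl)
    have "gcd h (pderiv h) * h ^ j dvd h ^ Suc j"
      by (simp add: mult_dvd_mono)
    then have "gcd h (pderiv h) * h ^ j dvd coeff m j"
      using m dvd_trans by (auto simp: pderiv_weylA_iff simp del: power_Suc)
    moreover have "gcd h (pderiv h) * h ^ j dvd kappa h t * h ^ j"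
      by (intro mult_dvd_mono gcd_dvd_kappa) simp
    ultimately show "?R j"
      using m by (auto simp: w * pderiv_weylA_iff)
  qed
next
  assume R: "\<forall>j. ?R j"
  obtain b b' where bezout: "b * h + b' * pderiv h = gcd h (pderiv h)"
    using bezout_coefficients_fst_snd by blast
  have "\<exists>t q. coeff w j = kappa h t * h ^ j + q * h ^ Suc j \<and> (p dvd Suc j \<longrightarrow> q = 0)" for j
  proof (cases "p dvd Suc j")
    case True
    then obtain t where "coeff w j = kappa h t * h ^ j" using R by metis
    then show ?thesis by (intro exI [of _ t] exI [of _ 0]) simp
  next
    case False
    then obtain r where "coeff w j = (b * h + b' * pderiv h) * h ^ j * r"
      using R unfolding bezout by (metis dvdE)
    \<comment> \<open>From the definition of \<open>kappa\<close>, b' h' r = kappa(-(b' r)) + (b'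
      r)' h, where b' is the Bezout coefficient and not a derivative.\<close>
    then have "coeff w j = kappa h (- (b' * r)) * h ^ j + (b * r + pderiv (b' * r)) * h ^ Suc j"
      by (simp add: kappa_def pderiv_minus algebra_simps)
    then show ?thesis using False by blast
  qed
  then obtain t q where tq: "\<And>j. coeff w j = kappa h (t j) * h ^ j + q j * h ^ Suc j"
    and q: "\<And>j. p dvd Suc j \<Longrightarrow> q j = 0"
    by metis
  define n where "n = degree w"
  define a where "a = (\<Sum>j\<le>n. monom (t j * h ^ j) j)"
  define m where "m = (\<Sum>j\<le>n. monom (q j * h ^ Suc j) j)"
  have "a \<in> weylA h" "m \<in> pderiv ` weylA h"
    using q by (auto simp: weylA_iff pderiv_weylA_iff a_def m_def poly_of_coeffs simp del: power_Suc image_iff)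
  moreover have "w = m + kappa_weyl h a"
  proof (rule poly_eqI)
    fix j
    have "coeff a j = (if j \<le> n then t j else 0) * h ^ j"
      by (simp add: a_def poly_of_coeffs)
    from coeff_kappa_weyl [OF this] show "coeff w j = coeff (m + kappa_weyl h a) j"
      using tq [of j] by (auto simp: m_def poly_of_coeffs n_def coeff_eq_0)
  qed
  ultimately show "w \<in> imD2 h" by (auto simp: imD2_eq simp del: image_iff)
qed

text \<open>In the Leibniz rule for y^p the terms with 0 < k < p vanish by their binomial
  coefficients, and the term k = p because the p-th derivative is zero.\<close>

lemma ymul_funpow_p: "(ymul ^^ p) b = monom 1 p * (b :: 'a weyl)"
proof (induction b rule: poly_monom_induct)
  case (monom g l)
  have "(of_nat (p choose k) :: 'a) = 0" if "k < p" "k \<noteq> 0" for k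
    using that dvd_choose_prime [of k p] prime_p by (simp add: of_nat_eq_0)
  moreover have "(pderiv ^^ p) g = 0"
  proof (rule poly_eqI)
    fix n
    \<comment> \<open>Among the p consecutive factors of the Pochhammer symbol, this is the index of
      the one divisible by p.\<close>
    define i where "i = p - Suc (n mod p)"
    have "i < p" using p_pos by (simp add: i_def)
    have "n mod p < p" using p_pos by simp
    then have "Suc n + i = (n - n mod p) + p" using mod_less_eq_dividend [of n p] by (simp add: i_def)
    then have "p dvd Suc n + i" by (metis dvd_add dvd_minus_mod dvd_refl)
    then have "p dvd pochhammer (Suc n) p"
      unfolding pochhammer_prod using \<open>i < p\<close>
      by (intro dvd_trans [OF _ dvd_prodI [of "{0..<p}" i]]) auto
    then have "(pochhammer (of_nat (Suc n)) p :: 'a) = 0"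
      by (simp only: pochhammer_of_nat of_nat_eq_0)
    then show "coeff ((pderiv ^^ p) g) n = coeff 0 n"
      by (simp add: coeff_higher_pderiv)
  qed
  ultimately have "(ymul ^^ p) (monom g l) = (\<Sum>k\<le>p. if k = 0 then monom g (p + l) else 0)"
    unfolding ymul_funpow_monom by (intro sum.cong refl) (auto simp: le_less)
  then show ?case by (simp add: mult_monom)
qed (simp_all add: ymul_funpow_add algebra_simps)

text \<open>Because \<open>y\<^sup>p\<close> is central.\<close>

lemma p_supported_weyl_mult:
  assumes "p_supported p (c :: 'a weyl)"
  shows "c \<odot> b = c * b"
proof -
  have "(ymul ^^ (p * i)) b = monom 1 (p * i) * b" for i
    by (induction i) (simp_all add: funpow_add ymul_funpow_p mult_monom flip: mult.assoc)
  then have "smult (coeff c j) ((ymul ^^ j) b) = monom (coeff c j) j * b" for j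
    using assms by (cases "p dvd j") (auto simp: p_supported_def smult_monom simp flip: mult_smult_left)
  then have "c \<odot> b = (\<Sum>j\<le>degree c. monom (coeff c j) j) * b"
    by (simp add: weyl_mult_altdef sum_distrib_right)
  then show ?thesis by (simp add: poly_as_sum_of_monoms)
qed

lemma centralizerA_x_iff: "c \<in> centralizerA_x h \<longleftrightarrow> c \<in> weylA h \<and> p_supported p c"
proof -
  have "c \<odot> wX = wX \<odot> c \<longleftrightarrow> pderiv c = 0"
    by (simp add: weyl_mult_wX)
  also have "\<dots> \<longleftrightarrow> (\<forall>j. (of_nat (Suc j) :: 'a poly) = 0 \<or> coeff c (Suc j) = 0)"
    by (simp add: poly_eq_iff [of "pderiv c"] coeff_pderiv del: of_nat_Suc)
  also have "\<dots> \<longleftrightarrow> p_supported p c"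
    unfolding p_supported_def of_nat_poly_eq_0 by (metis dvd_0_right old.nat.exhaust)
  finally show ?thesis by (auto simp: centralizerA_x_def)
qed

text \<open>Commuting with the two generators suffices. Commuting with x gives
  \<open>p_supported\<close>; commuting with \<open>wYhat h\<close> then reduces to h times
  \<open>cderiv z\<close> being zero, and h can be cancelled.\<close>

lemma centerA_iff: "z \<in> centerA h \<longleftrightarrow> z \<in> weylA h \<and> p_supported p z \<and> cderiv z = 0"
proof -
  have Y: "z \<odot> wYhat h = wYhat h \<odot> z \<longleftrightarrow> cderiv z = 0" if "p_supported p z"
  proof -
    have "z \<odot> wYhat h = smult h (pCons 0 z) + smult (pderiv h) z"
      by (simp add: p_supported_weyl_mult [OF that] wYhat_eq wpoly_def monom_Suc monom_0 algebra_simps)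
    moreover have "wYhat h \<odot> z = smult h (pCons 0 z) + smult h (cderiv z) + smult (pderiv h) z"
      by (simp add: wYhat_weyl_mult ymul_smult ymul_def smult_add_right cderiv_smult)
    ultimately show ?thesis using h by simp
  qed
  have "z \<odot> b = b \<odot> z" if "z \<odot> wX = wX \<odot> z" "z \<odot> wYhat h = wYhat h \<odot> z" "b \<in> weylA h" for b
    using that(3)
  proof induction
    case (mult a b)
    then show ?case by (metis weyl_mult_assoc)
  qed (simp_all add: that weyl_distribs weyl_mult_wscale_left weyl_mult_wscale_right)
  then have "z \<in> centerA h \<longleftrightarrow> z \<in> centralizerA_x h \<and> z \<odot> wYhat h = wYhat h \<odot> z"
    using weylA.gen_x weylA.gen_yhat by (auto simp: centerA_def centralizerA_x_def)
  then show ?thesis using Y by (auto simp: centralizerA_x_iff)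
qed

lemma coeff_mult_wxy:
  assumes "p_supported p (c :: 'a weyl)"
  shows "coeff (c \<odot> wxy g r) n = (if n < r then 0 else coeff c (n - r) * g)"
  unfolding p_supported_weyl_mult [OF assms] wxy_def mult.commute [of c] coeff_monom_mult
  by (simp add: mult.commute)

text \<open>Identifies the elements of A with all y-degrees congruent to r modulo p as multiples of
  h^r y^r by the centralizer of x: lower each degree by r and divide by h^r.\<close>

lemma residue_class_shift:
  assumes "a \<in> weylA h" "r < p" and supp: "\<And>i. i mod p \<noteq> r \<Longrightarrow> coeff a i = 0"
  shows "\<exists>c. c \<in> weylA h \<and> p_supported p c \<and> c \<odot> wxy (h ^ r) r = a"
proof -
  define c where "c = (\<Sum>i\<le>degree a. monom (coeff a (i + r) div h ^ r) i)"
  have c: "coeff c i * h ^ r = coeff a (i + r)" and c_dvd: "h ^ i dvd coeff c i" for i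
  proof -
    obtain q where q: "coeff a (i + r) = h ^ (i + r) * q"
      using \<open>a \<in> weylA h\<close> by (auto simp: weylA_iff elim: dvdE)
    have "coeff c i = coeff a (i + r) div h ^ r"
      by (simp add: c_def poly_of_coeffs coeff_eq_0)
    also have "\<dots> = h ^ i * q"
      using h by (simp add: q power_add mult_ac)
    finally show "coeff c i * h ^ r = coeff a (i + r)" "h ^ i dvd coeff c i"
      by (simp_all add: q power_add mult_ac)
  qed
  have "p_supported p c"
    unfolding p_supported_def
  proof (intro allI impI)
    fix i assume "\<not> p dvd i"
    then have "(i + r) mod p \<noteq> r"
      using \<open>r < p\<close> by (metis add_diff_cancel_right' dvd_minus_mod)
    then show "coeff c i = 0"
      using c [of i] supp [of "i + r"] h by simp
  qed
  moreover have "c \<odot> wxy (h ^ r) r = a"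
  proof (rule poly_eqI)
    fix n
    show "coeff (c \<odot> wxy (h ^ r) r) n = coeff a n"
      using c [of "n - r"] supp [of n] \<open>r < p\<close> by (auto simp: coeff_mult_wxy [OF \<open>p_supported p c\<close>])
  qed
  ultimately show ?thesis using c_dvd by (auto simp: weylA_iff)
qed

section \<open>Coefficientwise description of the two summands and their ambient modules\<close>

lemma Suc_mod_p: "p dvd Suc j \<longleftrightarrow> j mod p = p - 1"
  using p_pos by (auto simp: dvd_eq_mod_eq_0 mod_Suc)

text \<open>The summands of J are the residue classes 0, ..., p - 2 of the y-degree, so only the
  class of -1 is missing.\<close>

lemma Jset_iff: "a \<in> Jset h p \<longleftrightarrow> a \<in> weylA h \<and> (\<forall>j. p dvd Suc j \<longrightarrow> coeff a j = 0)"
proof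
  assume "a \<in> Jset h p"
  then obtain c where c: "\<And>j. j < p - 1 \<Longrightarrow> c j \<in> weylA h \<and> p_supported p (c j)"
    and a: "a = (\<Sum>j<p - 1. c j \<odot> wxy (h ^ j) j)"
    by (auto simp: Jset_def centralizerA_x_iff)
  have "wxy (h ^ j) j \<in> weylA h" for j
    by (simp add: weylA_iff wxy_def)
  then have "a \<in> weylA h"
    using c unfolding a by (intro weylA_sum weylA.mult) auto
  moreover have "coeff (c j \<odot> wxy (h ^ j) j) n = 0" if "p dvd Suc n" "j < p - 1" for n j
  proof (cases "n < j")
    case False
    have "\<not> p dvd n - j"
    proof
      assume "p dvd n - j"
      then have "p dvd Suc n - (n - j)" using that(1) by (rule dvd_diff_nat [rotated])
      then have "p dvd Suc j" using False by simp
      then show False using that(2) by (auto dest: dvd_imp_le)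
    qed
    then show ?thesis using c [OF that(2)] by (simp add: coeff_mult_wxy p_supported_def)
  qed (use c that in \<open>simp add: coeff_mult_wxy\<close>)
  ultimately show "a \<in> weylA h \<and> (\<forall>j. p dvd Suc j \<longrightarrow> coeff a j = 0)"
    by (auto simp: a coeff_sum)
next
  assume a: "a \<in> weylA h \<and> (\<forall>j. p dvd Suc j \<longrightarrow> coeff a j = 0)"
  have "\<exists>c. c \<in> weylA h \<and> p_supported p c \<and> c \<odot> wxy (h ^ j) j = residue_part p {j} a" if "j < p - 1" for j
    using a that by (intro residue_class_shift) (auto simp: weylA_iff)
  then obtain c where c: "\<And>j. j < p - 1 \<Longrightarrow>
      c j \<in> weylA h \<and> p_supported p (c j) \<and> c j \<odot> wxy (h ^ j) j = residue_part p {j} a"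
    by metis
  have "a = (\<Sum>j<p - 1. residue_part p {j} a)"
  proof (rule poly_eqI)
    fix n
    have "n mod p < p - 1" if "coeff a n \<noteq> 0"
      using a that Suc_mod_p [of n] p_pos mod_less_divisor [of p n] by fastforce
    then show "coeff a n = coeff (\<Sum>j<p - 1. residue_part p {j} a) n"
      by (auto simp: coeff_sum)
  qed
  also have "\<dots> = (\<Sum>j<p - 1. c j \<odot> wxy (h ^ j) j)"
    using c by simp
  finally show "a \<in> Jset h p"
    unfolding Jset_def mem_Collect_eq
    by (intro exI [of _ c] conjI) (use c in \<open>auto simp: centralizerA_x_iff\<close>)
qed

lemma gcd_Jset_iff:
  "a \<in> lmult_set (wpoly (gcd h (pderiv h))) (Jset h p) \<longleftrightarrow>
     (\<forall>j. gcd h (pderiv h) * h ^ j dvd coeff a j \<and> (p dvd Suc j \<longrightarrow> coeff a j = 0))"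
  (is "_ \<longleftrightarrow> ?R")
proof
  assume "a \<in> lmult_set (wpoly (gcd h (pderiv h))) (Jset h p)"
  then show ?R
    by (auto simp: lmult_set_def wpoly_weyl_mult Jset_iff weylA_iff intro: mult_dvd_mono)
next
  assume R: ?R
  then have "[:gcd h (pderiv h):] dvd a"
    unfolding const_poly_dvd_iff using dvd_mult_left by blast
  then obtain u where a: "a = smult (gcd h (pderiv h)) u"
    by (auto elim!: dvdE)
  then have "u \<in> Jset h p"
    using R h by (auto simp: Jset_iff weylA_iff)
  then show "a \<in> lmult_set (wpoly (gcd h (pderiv h))) (Jset h p)"
    by (auto simp: lmult_set_def wpoly_weyl_mult a)
qed

text \<open>A central element has coefficients s h^j with p dividing j and s' = 0, so s passes
  inside \<open>kappa\<close>. Conversely h^j y^j is central when p divides j, and one such factor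
  per degree suffices.\<close>

lemma ZKset_iff:
  "a \<in> ZKset h \<longleftrightarrow> p_supported p a \<and> (\<forall>j. \<exists>t. coeff a j = kappa h t * h ^ j)" (is "_ \<longleftrightarrow> ?R")
proof
  assume "a \<in> ZKset h"
  then obtain n :: nat and z k where zk: "\<And>i. i < n \<Longrightarrow> z i \<in> centerA h" "\<And>i. i < n \<Longrightarrow> k i \<in> Kset h"
    and a: "a = (\<Sum>i<n. z i \<odot> wpoly (k i))"
    by (auto simp: ZKset_def)
  have "\<exists>t. coeff (z i \<odot> wpoly (k i)) j = kappa h t * h ^ j \<and>
      (\<not> p dvd j \<longrightarrow> coeff (z i \<odot> wpoly (k i)) j = 0)" if i: "i < n" for i j
  proof -
    obtain t where t: "k i = kappa h t" using zk(2) [OF i] by (auto simp: Kset_def)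
    have z: "z i \<in> weylA h" "p_supported p (z i)" "cderiv (z i) = 0"
      using zk(1) [OF i] by (auto simp: centerA_iff)
    have *: "coeff (z i \<odot> wpoly (k i)) j = coeff (z i) j * kappa h t"
      by (simp add: p_supported_weyl_mult z wpoly_def t mult.commute)
    show ?thesis
    proof (cases "p dvd j")
      case True
      obtain s where s: "coeff (z i) j = s * h ^ j"
        using z(1) by (metis weylA_iff dvdE mult.commute)
      have "pderiv (h ^ j) = 0"
        using True by (simp add: pderiv_power of_nat_eq_0)
      moreover have "pderiv (coeff (z i) j) = 0"
        using z(3) by (metis coeff_0 coeff_cderiv)
      ultimately have "pderiv s = 0"
        using h by (simp add: s pderiv_mult)
      then show ?thesis
        using True by (intro exI [of _ "s * t"]) (simp add: * s kappa_mult)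
    next
      case False
      then show ?thesis
        using z(2) by (intro exI [of _ 0]) (simp add: * p_supported_def)
    qed
  qed
  then obtain t where t: "\<And>i j. i < n \<Longrightarrow> coeff (z i \<odot> wpoly (k i)) j = kappa h (t i j) * h ^ j"
    and supp: "\<And>i j. i < n \<Longrightarrow> \<not> p dvd j \<Longrightarrow> coeff (z i \<odot> wpoly (k i)) j = 0"
    by metis
  have kappa_sum: "(\<Sum>i<n. kappa h (f i)) = kappa h (\<Sum>i<n. f i)" for f
    by (induction n) (simp_all add: kappa_add)
  have "coeff a j = kappa h (\<Sum>i<n. t i j) * h ^ j" for j
    by (simp add: a coeff_sum t flip: sum_distrib_right kappa_sum)
  then show ?R
    using supp by (auto simp: p_supported_def a coeff_sum)
next
  assume R: ?R
  then obtain t where t: "\<And>j. coeff a j = kappa h (t j) * h ^ j" by metis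
  define z where "z i = (if p dvd i then monom (h ^ i) i else 0)" for i
  have z: "z i \<in> centerA h" for i
    by (auto simp: z_def centerA_iff p_supported_def weylA_iff cderiv_monom pderiv_power of_nat_eq_0)
  then have "z i \<odot> wpoly (kappa h (t i)) = monom (coeff a i) i" for i
    using R by (auto simp: p_supported_weyl_mult centerA_iff wpoly_def z_def smult_monom t p_supported_def)
  then have "(\<Sum>i<Suc (degree a). z i \<odot> wpoly (kappa h (t i))) = a"
    unfolding lessThan_Suc_atMost by (simp add: poly_as_sum_of_monoms)
  then show "a \<in> ZKset h"
    unfolding ZKset_def Kset_def mem_Collect_eq
    by (intro exI [of _ "Suc (degree a)"] exI [of _ z] exI [of _ "\<lambda>i. kappa h (t i)"]) (simp add: z)
qed

lemma centralizer_top_iff: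
  "a \<in> rmult_set (centralizerA_x h) (wxy (h ^ (p - 1)) (p - 1)) \<longleftrightarrow>
     a \<in> weylA h \<and> (\<forall>j. \<not> p dvd Suc j \<longrightarrow> coeff a j = 0)" (is "?L \<longleftrightarrow> ?R")
proof
  assume ?L
  then obtain c where c: "c \<in> weylA h" "p_supported p c" and a: "a = c \<odot> wxy (h ^ (p - 1)) (p - 1)"
    by (auto simp: rmult_set_def centralizerA_x_iff)
  have "wxy (h ^ (p - 1)) (p - 1) \<in> weylA h"
    by (simp add: weylA_iff wxy_def)
  moreover have "coeff a n = 0" if "\<not> p dvd Suc n" for n
  proof (cases "n < p - 1")
    case False
    then have "Suc n = (n - (p - 1)) + p" using p_pos by simp
    with that have "\<not> p dvd n - (p - 1)" by (metis dvd_add dvd_refl)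
    then show ?thesis using c by (simp add: a coeff_mult_wxy p_supported_def)
  qed (use c in \<open>simp add: a coeff_mult_wxy\<close>)
  ultimately show ?R using c by (simp add: a weylA.mult)
next
  assume ?R
  then have "\<exists>c. c \<in> weylA h \<and> p_supported p c \<and> c \<odot> wxy (h ^ (p - 1)) (p - 1) = a"
    using p_pos by (intro residue_class_shift) (auto simp: Suc_mod_p)
  then show ?L by (auto simp: rmult_set_def centralizerA_x_iff)
qed

text \<open>The right factor raises the y-degree and the exponent of h alike by p - 1; degrees
  divisible by p become those congruent to -1.\<close>

lemma ZK_top_iff:
  "a \<in> rmult_set (ZKset h) (wxy (h ^ (p - 1)) (p - 1)) \<longleftrightarrow>
     (\<forall>j. (\<exists>t. coeff a j = kappa h t * h ^ j) \<and> (\<not> p dvd Suc j \<longrightarrow> coeff a j = 0))" (is "?L \<longleftrightarrow> ?R")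
proof
  assume ?L
  then obtain c where c: "p_supported p c" "\<And>j. \<exists>t. coeff c j = kappa h t * h ^ j"
    and a: "a = c \<odot> wxy (h ^ (p - 1)) (p - 1)"
    by (auto simp: rmult_set_def ZKset_iff)
  have "(\<exists>t. coeff a n = kappa h t * h ^ n) \<and> (\<not> p dvd Suc n \<longrightarrow> coeff a n = 0)" for n
  proof (cases "n < p - 1")
    case True
    then show ?thesis using c by (auto simp: a coeff_mult_wxy intro: exI [of _ 0])
  next
    case False
    then have n: "n = (n - (p - 1)) + (p - 1)" "Suc n = (n - (p - 1)) + p" using p_pos by simp_all
    obtain t where "coeff c (n - (p - 1)) = kappa h t * h ^ (n - (p - 1))" using c by metis
    then have "coeff a n = kappa h t * h ^ n"
      using False by (simp add: a coeff_mult_wxy c mult.assoc flip: power_add)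
    moreover have "coeff a n = 0" if "\<not> p dvd Suc n"
    proof -
      have "\<not> p dvd n - (p - 1)" using that n(2) by (metis dvd_add dvd_refl)
      then show ?thesis using c(1) by (simp add: a coeff_mult_wxy p_supported_def)
    qed
    ultimately show ?thesis by blast
  qed
  then show ?R by blast
next
  assume R: ?R
  then have "a \<in> weylA h" by (metis weylA_iff dvd_triv_right)
  then have "\<exists>c. c \<in> weylA h \<and> p_supported p c \<and> c \<odot> wxy (h ^ (p - 1)) (p - 1) = a"
    using p_pos R by (intro residue_class_shift) (auto simp: Suc_mod_p)
  then obtain c where c: "p_supported p c" "c \<odot> wxy (h ^ (p - 1)) (p - 1) = a"
    by blast
  have "\<exists>t. coeff c j = kappa h t * h ^ j" for j
  proof -
    obtain t where "coeff a (j + (p - 1)) = kappa h t * h ^ (j + (p - 1))" using R by blast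
    moreover have "coeff a (j + (p - 1)) = coeff c j * h ^ (p - 1)"
      unfolding c(2) [symmetric] coeff_mult_wxy [OF c(1)] by simp
    ultimately have "(kappa h t * h ^ j) * h ^ (p - 1) = coeff c j * h ^ (p - 1)"
      by (simp add: power_add mult.assoc)
    then show ?thesis using h by (metis mult_right_cancel power_not_zero)
  qed
  then show ?L using c by (auto simp: rmult_set_def ZKset_iff)
qed

text \<open>Multiplied by h^(p-2), a value of \<open>kappa\<close> becomes the derivative of t
  h^(p-1), which has no term in degrees congruent to -1 modulo p.\<close>

lemma kappa_not_surj: "\<exists>k. monom 1 k \<notin> range (kappa h)"
proof -
  have "p \<ge> 2" using prime_p by (rule prime_ge_2_nat)
  then obtain q where q: "p = Suc (Suc q)" by (metis Suc_le_D numeral_2_eq_2 Suc_le_mono le_Suc_ex add_2_eq_Suc)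
  define D where "D = degree (h ^ q)"
  \<comment> \<open>Chosen so that the leading term of x^k h^(p-2), of degree k + D, sits in a
    degree congruent to -1 modulo p.\<close>
  define k where "k = (p - 1) * Suc D"
  have kD: "Suc (k + D) = p * Suc D"
    by (simp add: k_def q)
  have "monom 1 k \<noteq> kappa h t" for t
  proof
    assume eq: "monom 1 k = kappa h t"
    have "(of_nat (Suc q) :: 'a) = - 1"
      using of_nat_eq_0 [of p] by (simp add: q eq_neg_iff_add_eq_0 add.commute)
    then have "pderiv (h ^ Suc q) = - (h ^ q * pderiv h)"
      by (simp add: pderiv_power_Suc del: of_nat_Suc power_Suc)
    then have "h ^ q * kappa h t = pderiv (t * h ^ Suc q)"
      unfolding pderiv_mult by (simp add: kappa_def algebra_simps)
    then have "coeff (monom 1 k * h ^ q) (k + D) = of_nat (p * Suc D) * coeff (t * h ^ Suc q) (p * Suc D)"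
      unfolding eq [symmetric] kD [symmetric] coeff_pderiv [symmetric] by (simp add: mult.commute)
    moreover have "(of_nat (p * Suc D) :: 'a) = 0"
      by (simp only: of_nat_eq_0) simp
    ultimately have "coeff (h ^ q) D = 0"
      by (simp add: coeff_monom_mult del: of_nat_mult of_nat_Suc)
    then show False using h by (simp add: D_def)
  qed
  then show ?thesis by blast
qed

lemma not_subset_imD2: "\<exists>u\<in>weylA h. u \<notin> imD2 h"
proof -
  obtain k where k: "monom 1 k \<notin> range (kappa h)" using kappa_not_surj by blast
  define u where "u = monom (monom 1 k * h ^ (p - 1)) (p - 1)"
  have "u \<in> weylA h" by (simp add: u_def weylA_iff)
  moreover have "u \<notin> imD2 h"
  proof
    assume "u \<in> imD2 h"
    then obtain t where "coeff u (p - 1) = kappa h t * h ^ (p - 1)"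
      using p_pos unfolding imD2_iff by (metis Suc_pred' dvd_refl)
    then have "monom 1 k = kappa h t" using h by (simp add: u_def)
    then show False using k by blast
  qed
  ultimately show ?thesis by blast
qed

end

section \<open>Assembly of the decomposition and the module isomorphism\<close>

theorem theorem3p6:
  fixes h :: "'a::field_gcd poly" and p :: nat
  assumes "CHAR('a) = p" and "p > 0" and "h \<noteq> 0"
  shows "imD2 h = {u + v | u v. u \<in> lmult_set (wpoly (gcd h (pderiv h))) (Jset h p) \<and>
                               v \<in> rmult_set (ZKset h) (wxy (h ^ (p - 1)) (p - 1))}
       \<and> lmult_set (wpoly (gcd h (pderiv h))) (Jset h p) \<inter> rmult_set (ZKset h) (wxy (h ^ (p - 1)) (p - 1)) = {0}
       \<and> HH2_iso h (Jset h p) (lmult_set (wpoly (gcd h (pderiv h))) (Jset h p))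
              (rmult_set (centralizerA_x h) (wxy (h ^ (p - 1)) (p - 1)))
              (rmult_set (ZKset h) (wxy (h ^ (p - 1)) (p - 1)))
       \<and> (\<exists>f. is_cocycle2 h f \<and> \<not> is_coboundary2 h f)"
  (is "_ = ?sum \<and> ?N1 \<inter> ?N2 = _ \<and> HH2_iso h ?T1 ?N1 ?T2 ?N2 \<and> _")
proof (intro conjI)
  note char = assms
  note iffs = imD2_iff [OF char] gcd_Jset_iff [OF char] ZK_top_iff [OF char] Jset_iff [OF char]
    centralizer_top_iff [OF char]
  \<comment> \<open>\<open>P2\<close> projects onto the y-degrees congruent to -1 modulo p and
    \<open>P1\<close> onto all others; residues stay below p, so the half-line in \<open>P2\<close>
    means the single class p - 1.\<close>
  define P1 where "P1 = (residue_part p {..<p - 1} :: 'a weyl \<Rightarrow> _)"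
  define P2 where "P2 = (residue_part p {p - 1 ..} :: 'a weyl \<Rightarrow> _)"
  have coeff_P1: "coeff (P1 a) j = (if p dvd Suc j then 0 else coeff a j)"
    and coeff_P2: "coeff (P2 a) j = (if p dvd Suc j then coeff a j else 0)" for a :: "'a weyl" and j
    using mod_less_divisor [OF \<open>p > 0\<close>, of j] by (auto simp: P1_def P2_def Suc_mod_p [OF char])
  have P12: "P1 a + P2 a = a" for a :: "'a weyl"
    by (simp add: poly_eq_iff [of "_ + _"] coeff_P1 coeff_P2)
  have kappa_0: "\<exists>t. 0 = kappa h t * h ^ j" for j
    by (rule exI [of _ 0]) simp
  have imD2_P: "w \<in> imD2 h \<longleftrightarrow> P1 w \<in> ?N1 \<and> P2 w \<in> ?N2" for w
    unfolding iffs coeff_P1 coeff_P2 using kappa_0 by (auto split: if_splits)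
  show "imD2 h = ?sum"
  proof (intro set_eqI iffI)
    fix w assume "w \<in> imD2 h"
    then have "P1 w \<in> ?N1 \<and> P2 w \<in> ?N2" by (simp only: imD2_P)
    then show "w \<in> ?sum" using P12 [of w, symmetric] by blast
  next
    fix w assume "w \<in> ?sum"
    then obtain u v where uv: "u \<in> ?N1" "v \<in> ?N2" and w: "w = u + v" by blast
    then have "P1 w = u" "P2 w = v"
      unfolding iffs by (auto simp: poly_eq_iff [of "P1 _"] poly_eq_iff [of "P2 _"] coeff_P1 coeff_P2)
    then show "w \<in> imD2 h" using uv by (simp only: imD2_P)
  qed
  show "?N1 \<inter> ?N2 = {0}"
  proof -
    have "0 \<in> ?N1 \<inter> ?N2" using kappa_0 unfolding Int_iff iffs by simp
    moreover have "a = 0" if "a \<in> ?N1 \<inter> ?N2" for a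
      using that unfolding Int_iff iffs by (auto simp: poly_eq_iff [of a 0])
    ultimately show ?thesis by blast
  qed
  have zero: "0 \<in> ?N1" "0 \<in> ?N2"
    using kappa_0 unfolding iffs by simp_all
  have P_diff: "P1 (a - b) = P1 a - P1 b" "P2 (a - b) = P2 a - P2 b"
    and P_add: "P1 (a + b) = P1 a + P1 b" "P2 (a + b) = P2 a + P2 b" for a b :: "'a weyl"
    by (auto simp: poly_eq_iff [of "P1 _"] poly_eq_iff [of "P2 _"] coeff_P1 coeff_P2)
  have P_T: "P1 a \<in> ?T1" "P2 a \<in> ?T2" if "a \<in> weylA h" for a
    using that unfolding iffs by (auto simp: coeff_P1 coeff_P2 weylA_iff)
  \<comment> \<open>Central elements live in y-degrees divisible by p, so multiplication by them
    preserves residue classes; this gives linearity over the center.\<close>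
  have P_center: "P1 (z \<odot> a) = z \<odot> P1 a" "P2 (z \<odot> a) = z \<odot> P2 a" if "z \<in> centerA h" for z a
  proof -
    have z: "p_supported p z" using that by (simp add: centerA_iff [OF char])
    have P1_z: "P1 (z \<odot> a) = z \<odot> P1 a"
    proof (rule poly_eqI)
      fix n
      have *: "coeff z i * coeff (P1 a) (n - i) = (if p dvd Suc n then 0 else coeff z i * coeff a (n - i))"
        if "i \<le> n" for i
      proof (cases "p dvd i")
        case True
        have "Suc n = i + Suc (n - i)" using that by simp
        then have "p dvd Suc n \<longleftrightarrow> p dvd Suc (n - i)" using True by (metis dvd_add_right_iff)
        then show ?thesis by (simp add: coeff_P1)
      qed (use z in \<open>simp add: p_supported_def\<close>)
      have "coeff (z \<odot> P1 a) n = (\<Sum>i\<le>n. if p dvd Suc n then 0 else coeff z i * coeff a (n - i))"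
        unfolding p_supported_weyl_mult [OF char z] coeff_mult by (intro sum.cong refl *) simp
      then show "coeff (P1 (z \<odot> a)) n = coeff (z \<odot> P1 a) n"
        by (simp add: coeff_P1 p_supported_weyl_mult [OF char z] coeff_mult)
    qed
    moreover have "P2 b = b - P1 b" for b :: "'a weyl"
      using P12 [of b] by (metis add_diff_cancel_left')
    ultimately show "P1 (z \<odot> a) = z \<odot> P1 a" "P2 (z \<odot> a) = z \<odot> P2 a"
      by (simp_all add: weyl_distribs)
  qed
  \<comment> \<open>The representative map splits the obstruction into its two residue parts; the
    kernel clause is \<open>coboundary2_iff_obstruction\<close> and surjectivity is
    \<open>obstruction_surj\<close>.\<close>
  show "HH2_iso h ?T1 ?N1 ?T2 ?N2"
    unfolding HH2_iso_def
  proof (intro exI [of _ "\<lambda>f. (P1 (obstruction h f), P2 (obstruction h f))"] conjI allI ballI impI;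
      unfold fst_conv snd_conv)
    fix f assume "is_cocycle2 h f"
    then have "obstruction h f \<in> weylA h" by (intro obstruction_in cocycle2_cochain2)
    then show "P1 (obstruction h f) \<in> ?T1" "P2 (obstruction h f) \<in> ?T2"
      by (simp_all only: P_T)
  next
    fix f f' assume "is_cocycle2 h f" "is_cocycle2 h f'"
    then show "is_coboundary2 h (\<lambda>a b. f a b - f' a b) \<longleftrightarrow>
        P1 (obstruction h f) - P1 (obstruction h f') \<in> ?N1 \<and>
        P2 (obstruction h f) - P2 (obstruction h f') \<in> ?N2"
      by (simp only: coboundary2_iff_obstruction [OF \<open>h \<noteq> 0\<close> cocycle2_diff] imD2_P obstruction_diff P_diff)
  next
    fix u v assume uv: "u \<in> ?T1" "v \<in> ?T2"
    then have "u + v \<in> weylA h" unfolding iffs by (simp add: weylA.add)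
    then obtain f where f: "is_cocycle2 h f" "obstruction h f = u + v"
      using obstruction_surj [OF \<open>h \<noteq> 0\<close>] by blast
    have "P1 (u + v) = u" "P2 (u + v) = v"
      using uv unfolding iffs by (auto simp: poly_eq_iff [of "P1 _"] poly_eq_iff [of "P2 _"] coeff_P1 coeff_P2)
    then show "\<exists>f. is_cocycle2 h f \<and> P1 (obstruction h f) - u \<in> ?N1 \<and> P2 (obstruction h f) - v \<in> ?N2"
      using f zero by (intro exI [of _ f]) simp
  qed (simp_all only: obstruction_add obstruction_center_mult P_add P_center diff_self zero)
  show "\<exists>f. is_cocycle2 h f \<and> \<not> is_coboundary2 h f"
    using not_subset_imD2 [OF char] obstruction_surj [OF \<open>h \<noteq> 0\<close>] coboundary2_iff_obstruction [OF \<open>h \<noteq> 0\<close>]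
    by metis
qed

end
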